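(* Let $n\in\mathbb{N}$, let $H$ be an $n\times n$ random matrix from the $GUE(n)$, and let $U\in U(n)$ be Haar-distributed and independent of $H$. Then for all $j\in\mathbb{N}$, $j\geq 1$, and $\sigma_1,\dots,\sigma_j\in\mathbb{N}$, $$\mathbb{E}\Big(\mathrm{Tr}\big(HU^{\sigma_1}HU^{\sigma_2}\cdots HU^{\sigma_j}\big)\,\overline{\mathrm{Tr}\big(HU^{\sigma_1}HU^{\sigma_2}\cdots HU^{\sigma_j}\big)}\Big)=\sum_{\pi\in C_{2j}}\mathbb{E}\Big(\prod_{o\in\mathcal{O}_{\tilde\pi\rho}}\mathrm{Tr}\big(U^{\sum_{w\in o}\hat\sigma_{w}}\big)\Big),$$ where $C_{2j}$, $\tilde\pi$, $\rho$, $\mathcal{O}_{\tilde\pi\rho}$ and $\hat\sigma_w$ ($w\in\{2,4,\dots,4j\}$) are as defined in the context.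
   Context: $GUE(n)$: $H$ is Hermitian with $H_{ii}\sim\mathcal{N}(0,1)$ for $1\le i\le n$, and for $1\le i<l\le n$, $\Re H_{il}=\Re H_{li}\sim\mathcal{N}(0,1/2)$, $\Im H_{il}=-\Im H_{li}\sim\mathcal{N}(0,1/2)$, all these real variables being independent up to the Hermitian symmetry. Pairings: $C_{2j}=\{\pi\in S_{2j}:\pi^2=\mathrm{Id},\ \pi(l)\ne l\ \text{for all } l\in\{1,\dots,2j\}\}$, and $C_{4j}$ is defined likewise. For $\pi\in C_{2j}$, $\tilde\pi\in C_{4j}$ is defined by $\tilde\pi(2l-1)=2\pi(l)$ and $\tilde\pi(2l)=2\pi(l)-1$ for $l=1,\dots,2j$. The pairing $\rho\in C_{4j}$ is the product of the disjoint transpositions $(2l,\,2l+1)$ for $1\le l\le j-1$; $(2j,\,1)$; $(2j+2l-1,\,2j+2l+2)$ for $1\le l\le j-1$; and $(4j-1,\,2j+2)$. Both $\rho$ and $\tilde\pi$ exchange even and odd numbers, so the composition $\tilde\pi\rho$ (first $\rho$, then $\tilde\pi$) restricts to a permutation of the set of even numbers $\{2,4,\dots,4j\}$. $\mathcal{O}_{\tilde\pi\rho}$ denotes the set of orbits (cycles) of this permutation on $\{2,4,\dots,4j\}$. Exponents: for even $w=2l\in\{2,4,\dots,4j\}$, $$\hat\sigma_{2l}=\begin{cases}\sigma_l,& l=1,\dots,j,\\ -\sigma_j,& l=j+1,\\ -\sigma_{l-j-1},& l=j+2,\dots,2j.\end{cases}$$ Negative powers of $U$ are powers of $U^{-1}=U^*$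 and $U^0=I_n$. *)

theory Defs
  imports "HOL-Probability.Probability" "HOL-Combinatorics.Combinatorics"
begin

definition conj_transpose :: "complex^'n^'m \<Rightarrow> complex^'m^'n" where
  "conj_transpose A = (\<chi> i k. cnj (A $ k $ i))"

definition unitary_matrices :: "(complex^'n^'n) set" where
  "unitary_matrices = {A. conj_transpose A ** A = mat 1 \<and> A ** conj_transpose A = mat 1}"

text \<open>The power operation of the type class on vectors is componentwise, hence separate
  definitions of the powers with respect to the matrix product.\<close>

definition mat_pow :: "complex^'n^'n \<Rightarrow> nat \<Rightarrow> complex^'n^'n" where
  "mat_pow A k = ((\<lambda>B. B ** A) ^^ k) (mat 1)"

definition mat_powi :: "complex^'n^'n \<Rightarrow> int \<Rightarrow> complex^'n^'n" where
  "mat_powi A k = (if 0 \<le> k then mat_pow A (nat k) else mat_pow (matrix_inv A) (nat (- k)))"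

text \<open>\<open>mat_word A B s j\<close> is \<open>A B\<^sup>s\<^sup>(\<^sup>1\<^sup>) A B\<^sup>s\<^sup>(\<^sup>2\<^sup>) \<dots> A B\<^sup>s\<^sup>(\<^sup>j\<^sup>)\<close>.\<close>

primrec mat_word ::
  "complex^'n^'n \<Rightarrow> complex^'n^'n \<Rightarrow> (nat \<Rightarrow> nat) \<Rightarrow> nat \<Rightarrow> complex^'n^'n"
where
  "mat_word A B s 0 = mat 1"
| "mat_word A B s (Suc k) = mat_word A B s k ** (A ** mat_pow B (s (Suc k)))"

text \<open>The matrix size is \<open>CARD('n)\<close>; the linear order on the index type \<open>'n\<close> replaces that of
  \<open>{1..n}\<close>. The independent family consists of the \<open>Re H\<^sub>i\<^sub>l\<close> for \<open>i \<le> l\<close> (tagged \<open>Inl\<close>) and the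
  \<open>Im H\<^sub>i\<^sub>l\<close> for \<open>i < l\<close> (tagged \<open>Inr\<close>). The second parameter of \<^const>\<open>normal_density\<close> is the
  standard deviation, not the variance.\<close>

definition GUE :: "'a measure \<Rightarrow> ('a \<Rightarrow> complex^'n::{finite,linorder}^'n::{finite,linorder}) \<Rightarrow> bool"
where
  "GUE M H \<longleftrightarrow>
     (\<forall>\<omega>\<in>space M. conj_transpose (H \<omega>) = H \<omega>) \<and>
     (\<forall>i. distributed M lborel (\<lambda>\<omega>. Re (H \<omega> $ i $ i)) (normal_density 0 1)) \<and>
     (\<forall>i l. i < l \<longrightarrow>
        distributed M lborel (\<lambda>\<omega>. Re (H \<omega> $ i $ l)) (normal_density 0 (sqrt (1 / 2))) \<and>
        distributed M lborel (\<lambda>\<omega>. Im (H \<omega> $ i $ l)) (normal_density 0 (sqrt (1 / 2)))) \<and>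
     prob_space.indep_vars M (\<lambda>_. borel)
       (case_sum (\<lambda>(i, l) \<omega>. Re (H \<omega> $ i $ l)) (\<lambda>(i, l) \<omega>. Im (H \<omega> $ i $ l)))
       ({(i, l). i \<le> l} <+> {(i, l). i < l})"

definition unitary_borel :: "(complex^'n^'n) measure" where
  "unitary_borel = restrict_space borel unitary_matrices"

text \<open>The normalized Haar measure on the compact group \<open>U(n)\<close>: the translation invariant Borel
  probability measure.\<close>

definition is_haar :: "(complex^'n^'n) measure \<Rightarrow> bool" where
  "is_haar \<mu> \<longleftrightarrow> prob_space \<mu> \<and> sets \<mu> = sets unitary_borel \<and>
     (\<forall>V\<in>unitary_matrices. distr \<mu> unitary_borel (\<lambda>A. V ** A) = \<mu>)"

definition haar_distributed :: "'a measure \<Rightarrow> ('a \<Rightarrow> complex^'n^'n) \<Rightarrow> bool" where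
  "haar_distributed M U \<longleftrightarrow> U \<in> measurable M unitary_borel \<and> is_haar (distr M unitary_borel U)"

text \<open>\<^const>\<open>permutes\<close> makes a permutation of \<open>{1..m}\<close> a function on all of \<open>nat\<close>,
  the identity outside \<open>{1..m}\<close>.\<close>

definition pairings :: "nat \<Rightarrow> (nat \<Rightarrow> nat) set" where
  "pairings m = {\<pi>. \<pi> permutes {1..m} \<and> \<pi> \<circ> \<pi> = id \<and> (\<forall>l\<in>{1..m}. \<pi> l \<noteq> l)}"

definition doubled :: "nat \<Rightarrow> (nat \<Rightarrow> nat) \<Rightarrow> nat \<Rightarrow> nat" where
  "doubled j \<pi> w =
     (if w \<in> {1..4 * j} then
        if odd w then 2 * \<pi> ((w + 1) div 2) else 2 * \<pi> (w div 2) - 1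
      else w)"

definition rho :: "nat \<Rightarrow> nat \<Rightarrow> nat" where
  "rho j =
     foldr (\<lambda>(a, b) f. Transposition.transpose a b \<circ> f)
       (map (\<lambda>l. (2 * l, 2 * l + 1)) [1..<j] @ [(2 * j, 1)] @
        map (\<lambda>l. (2 * j + 2 * l - 1, 2 * j + 2 * l + 2)) [1..<j] @ [(4 * j - 1, 2 * j + 2)])
       id"

definition even_orbits :: "nat \<Rightarrow> (nat \<Rightarrow> nat) \<Rightarrow> nat set set" where
  "even_orbits j \<pi> = orbit (doubled j \<pi> \<circ> rho j) ` {w \<in> {1..4 * j}. even w}"

definition sigma_hat :: "(nat \<Rightarrow> nat) \<Rightarrow> nat \<Rightarrow> nat \<Rightarrow> int" where
  "sigma_hat \<sigma> j w =
     (let l = w div 2 in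
      if l \<le> j then int (\<sigma> l)
      else if l = j + 1 then - int (\<sigma> j)
      else - int (\<sigma> (l - j - 1)))"

end

theory Submission
  imports Defs
begin

text \<open>
  Expanding both traces, the left-hand integrand is the sum over \<open>a, b : {1..2 j} \<rightarrow> {1..n}\<close> of
  \<open>(\<Prod>m. H (a m) (b m)) * (\<Prod>m. N m (b m) (a (r m)))\<close>, where \<open>N m\<close> is the power of \<open>U\<close> with exponent
  \<open>\<sigma>\<close>-hat at \<open>2 m\<close> and \<open>r\<close> describes \<open>\<rho>\<close> on even numbers. By independence, the first product may be
  replaced by its expectation, which by Wick's formula is the number of pairings \<open>\<pi>\<close> with
  \<open>a = b \<circ> \<pi>\<close>. For a fixed \<open>\<pi>\<close>, the remaining sum over \<open>b\<close> of \<open>\<Prod>m. N m (b m) (b (\<pi> (r m)))\<close> splits into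
  one factor for each cycle of \<open>\<pi> \<circ> r\<close>, the trace of the product of the \<open>N m\<close> along the cycle; these
  are powers of \<open>U\<close>, so only the sum of the exponents matters.
\<close>

section \<open>Unitary matrices\<close>

text \<open>The conjugate trace needs no separate Wick rule: as \<open>H\<close> is Hermitian,
  conjugation only reverses the word, so both traces together form one index sum with 2j copies of
  \<open>H\<close>. This explains the shape of \<rho>: its first half closes the cycle 1, ..., j,
  its second half runs backwards through j + 1, ..., 2j, with exponents that are negative and
  shifted by one place. Wick's formula comes from Gaussian integration by parts: contracting one
  entry with each possible partner is the same recursion that pairings satisfy when they are
  classified by the partner of a chosen point. The pairing condition is the covariance of two
  entries, which is 1 exactly for transposed positions. Since the cycles vary with \<pi>, no product
  along a cycle is ever written down; indices are summed out one at a time, each matrix being merged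
  into its predecessor. The interchanges are legitimate because Gaussian moments are finite and
  entries of unitary matrices have modulus at most 1.\<close>

lemma conj_transpose_nth [simp]: "conj_transpose A $ i $ k = cnj (A $ k $ i)"
  by (simp add: conj_transpose_def)

lemma conj_transpose_mult: "conj_transpose (A ** B) = conj_transpose B ** conj_transpose A"
  by (simp add: vec_eq_iff matrix_matrix_mult_def mult.commute)

lemma conj_transpose_mat_1 [simp]: "conj_transpose (mat 1) = mat 1"
  by (simp add: vec_eq_iff mat_def)

lemma conj_transpose_conj_transpose [simp]: "conj_transpose (conj_transpose A) = A"
  by (simp add: vec_eq_iff)

lemma mat_pow_0 [simp]: "mat_pow A 0 = mat 1"
  and mat_pow_Suc: "mat_pow A (Suc k) = mat_pow A k ** A"
  by (simp_all add: mat_pow_def)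

lemma mat_pow_add: "mat_pow A (k + l) = mat_pow A k ** mat_pow A l"
  by (induction l) (simp_all add: mat_pow_Suc matrix_mul_assoc)

lemma mat_pow_Suc': "mat_pow A (Suc k) = A ** mat_pow A k"
  using mat_pow_add[of A 1 k] by (simp add: mat_pow_Suc)

lemma conj_transpose_mat_pow: "conj_transpose (mat_pow A k) = mat_pow (conj_transpose A) k"
proof (induction k)
  case (Suc k)
  then show ?case
    by (subst mat_pow_Suc, subst mat_pow_Suc') (simp add: conj_transpose_mult)
qed simp

lemma unitary_mat_1: "mat 1 \<in> unitary_matrices"
  by (simp add: unitary_matrices_def)

lemma unitary_mult:
  assumes "A \<in> unitary_matrices" "B \<in> unitary_matrices"
  shows "A ** B \<in> unitary_matrices"
proof -
  have "conj_transpose (A ** B) ** (A ** B) = conj_transpose B ** (conj_transpose A ** A) ** B"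
    by (simp add: conj_transpose_mult matrix_mul_assoc)
  moreover have "(A ** B) ** conj_transpose (A ** B) = A ** (B ** conj_transpose B) ** conj_transpose A"
    by (simp add: conj_transpose_mult matrix_mul_assoc)
  ultimately show ?thesis
    using assms by (simp add: unitary_matrices_def)
qed

lemma unitary_conj_transpose: "A \<in> unitary_matrices \<Longrightarrow> conj_transpose A \<in> unitary_matrices"
  by (simp add: unitary_matrices_def)

lemma unitary_mat_pow: "A \<in> unitary_matrices \<Longrightarrow> mat_pow A k \<in> unitary_matrices"
  by (induction k) (simp_all add: mat_pow_Suc unitary_mat_1 unitary_mult)

lemma unitary_matrix_inv:
  assumes "A \<in> unitary_matrices"
  shows "matrix_inv A = conj_transpose A"
proof -
  have inv: "A ** conj_transpose A = mat 1 \<and> conj_transpose A ** A = mat 1"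
    using assms by (simp add: unitary_matrices_def)
  then have "A ** matrix_inv A = mat 1"
    unfolding matrix_inv_def by (rule someI2) simp
  then have "conj_transpose A ** (A ** matrix_inv A) = conj_transpose A"
    by simp
  then show ?thesis
    using inv by (simp add: matrix_mul_assoc)
qed

lemma mat_powi_unitary:
  assumes "A \<in> unitary_matrices"
  shows "mat_powi A k = (if 0 \<le> k then mat_pow A (nat k) else mat_pow (conj_transpose A) (nat (- k)))"
  using assms by (simp add: mat_powi_def unitary_matrix_inv)

lemma mat_powi_of_nat [simp]: "mat_powi A (int k) = mat_pow A k"
  by (simp add: mat_powi_def)

lemma mat_powi_minus_of_nat:
  "A \<in> unitary_matrices \<Longrightarrow> mat_powi A (- int k) = conj_transpose (mat_pow A k)"
  by (simp add: mat_powi_unitary conj_transpose_mat_pow)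

lemma unitary_mat_powi: "A \<in> unitary_matrices \<Longrightarrow> mat_powi A k \<in> unitary_matrices"
  by (simp add: mat_powi_unitary unitary_mat_pow unitary_conj_transpose)

lemma mat_powi_add_1:
  assumes "A \<in> unitary_matrices"
  shows "mat_powi A (k + 1) = A ** mat_powi A k"
proof (cases "0 \<le> k")
  case True
  then have "nat (k + 1) = Suc (nat k)"
    by simp
  then show ?thesis
    using True by (simp add: mat_powi_def mat_pow_Suc')
next
  case False
  \<comment> \<open>With this shift both \<open>k\<close> and \<open>k + 1\<close> are negatives of
    naturals, so both powers are powers of \<open>conj_transpose A\<close> and one factor cancels
    against \<open>A\<close>.\<close>
  define l where "l = nat (- k - 1)"
  have k: "k = - int (Suc l)" "k + 1 = - int l"
    using False by (simp_all add: l_def)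
  have "mat_powi A (- int (Suc l)) = conj_transpose A ** mat_powi A (- int l)"
    unfolding mat_powi_minus_of_nat[OF assms] conj_transpose_mat_pow by (rule mat_pow_Suc')
  then have "mat_powi A k = conj_transpose A ** mat_powi A (k + 1)"
    unfolding k(2) by (simp only: k(1))
  then have "A ** mat_powi A k = (A ** conj_transpose A) ** mat_powi A (k + 1)"
    by (simp add: matrix_mul_assoc)
  then show ?thesis
    using assms by (simp add: unitary_matrices_def)
qed

text \<open>The law by which only the exponent sum along a cycle survives. For negative steps,
  unitarity lets \<open>conj_transpose A\<close> undo a factor \<open>A\<close>.\<close>

lemma mat_powi_add:
  assumes A: "A \<in> unitary_matrices"
  shows "mat_powi A (k + l) = mat_powi A k ** mat_powi A l"
proof (induction k rule: int_induct[where k = 0])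
  case base
  then show ?case by (simp add: mat_powi_def)
next
  case (step1 k)
  have "mat_powi A (k + 1 + l) = A ** mat_powi A (k + l)"
    using mat_powi_add_1[OF A, of "k + l"] by (simp add: algebra_simps)
  then show ?case
    using step1 by (simp add: mat_powi_add_1[OF A] matrix_mul_assoc)
next
  case (step2 k)
  have B: "mat_powi A (m - 1) = conj_transpose A ** mat_powi A m" for m
  proof -
    have "mat_powi A m = A ** mat_powi A (m - 1)"
      using mat_powi_add_1[OF A, of "m - 1"] by simp
    then have "conj_transpose A ** mat_powi A m = (conj_transpose A ** A) ** mat_powi A (m - 1)"
      by (simp add: matrix_mul_assoc)
    then show ?thesis
      using A by (simp add: unitary_matrices_def)
  qed
  have "mat_powi A (k - 1 + l) = conj_transpose A ** mat_powi A (k + l)"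
    using B[of "k + l"] by (simp add: algebra_simps)
  then show ?case
    using step2 by (simp add: B matrix_mul_assoc)
qed

text \<open>Rows of a unitary matrix are unit vectors, as the diagonal of
  \<open>A ** conj_transpose A\<close> shows. The bound later gives integrability of the products of
  entries of powers of \<open>U\<close>.\<close>

lemma norm_unitary_nth_le_1:
  assumes "A \<in> unitary_matrices"
  shows "norm (A $ i $ k) \<le> 1"
proof -
  have "(A ** conj_transpose A) $ i $ i = 1"
    using assms by (simp add: unitary_matrices_def mat_def)
  then have "(\<Sum>l\<in>UNIV. complex_of_real ((norm (A $ i $ l))\<^sup>2)) = 1"
    by (simp add: matrix_matrix_mult_def complex_norm_square del: of_real_power)
  then have "(\<Sum>l\<in>UNIV. (norm (A $ i $ l))\<^sup>2) = 1"
    by (metis of_real_eq_1_iff of_real_sum)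
  moreover have "(norm (A $ i $ k))\<^sup>2 \<le> (\<Sum>l\<in>UNIV. (norm (A $ i $ l))\<^sup>2)"
    by (rule member_le_sum) auto
  ultimately show ?thesis
    using power2_le_imp_le[of "norm (A $ i $ k)" 1] by simp
qed

section \<open>Measurability of the entries of matrix powers\<close>

lemma borel_measurable_mat_nth [measurable]:
  "(\<lambda>A :: complex^'n^'m. A $ i $ k) \<in> borel_measurable borel"
  by (intro borel_measurable_continuous_onI continuous_intros)

lemma continuous_on_mat_pow_nth:
  assumes "\<And>i k. continuous_on S (\<lambda>x. f x $ i $ k)"
  shows "continuous_on S (\<lambda>x. mat_pow (f x) m $ i $ k)"
proof (induction m arbitrary: i k)
  case 0
  then show ?case by (simp add: mat_def)
next
  case (Suc m)
  then show ?case
    by (simp add: mat_pow_Suc matrix_matrix_mult_def assms continuous_intros)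
qed

text \<open>\<open>matrix_inv\<close> is given by choice and has no evident measurability; on
  unitary matrices it is \<open>conj_transpose\<close>, so the entries of the power are continuous
  functions of \<open>A\<close>.\<close>

lemma borel_measurable_mat_powi_nth [measurable]:
  "(\<lambda>A. mat_powi A m $ i $ k) \<in> borel_measurable unitary_borel"
proof -
  have "(\<lambda>A. if 0 \<le> m then mat_pow A (nat m) $ i $ k
      else mat_pow (conj_transpose A) (nat (- m)) $ i $ k) \<in> borel_measurable borel"
    by (cases "0 \<le> m"; simp; intro borel_measurable_continuous_onI continuous_on_mat_pow_nth)
      (auto intro!: continuous_intros)
  then have "(\<lambda>A. if 0 \<le> m then mat_pow A (nat m) $ i $ k
      else mat_pow (conj_transpose A) (nat (- m)) $ i $ k) \<in> borel_measurable unitary_borel"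
    unfolding unitary_borel_def by (rule measurable_restrict_space1)
  then show ?thesis
    by (rule measurable_cong[THEN iffD1, rotated])
      (auto simp: unitary_borel_def space_restrict_space mat_powi_unitary)
qed

section \<open>Sums over cycles of indices\<close>

text \<open>A trace spread over a permutation: for a single cycle this is the trace of the product
  of the \<open>N w\<close> in cyclic order, for several cycles the product of such traces. The
  column index of \<open>N w\<close> is the row index of its successor.\<close>

definition cyc_sum :: "'i set \<Rightarrow> ('i \<Rightarrow> 'i) \<Rightarrow> ('i \<Rightarrow> complex^'n^'n) \<Rightarrow> complex" where
  "cyc_sum W \<tau> N = (\<Sum>a\<in>W \<rightarrow>\<^sub>E UNIV. \<Prod>w\<in>W. N w $ a w $ a (\<tau> w))"

lemma cyc_sum_empty [simp]: "cyc_sum {} \<tau> N = 1"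
  by (simp add: cyc_sum_def)

lemma cyc_sum_cong:
  assumes "\<And>w. w \<in> W \<Longrightarrow> \<tau> w = \<tau>' w" "\<And>w. w \<in> W \<Longrightarrow> N w = N' w"
  shows "cyc_sum W \<tau> N = cyc_sum W \<tau>' N'"
  unfolding cyc_sum_def using assms by (intro sum.cong prod.cong) auto

lemma sum_PiE_insert:
  assumes "x \<notin> W"
  shows "(\<Sum>a\<in>insert x W \<rightarrow>\<^sub>E S. f a) = (\<Sum>y\<in>S. \<Sum>a\<in>W \<rightarrow>\<^sub>E S. f (a(x := y)))"
proof -
  have "(\<Sum>a\<in>insert x W \<rightarrow>\<^sub>E S. f a) = (\<Sum>(y, a)\<in>S \<times> (W \<rightarrow>\<^sub>E S). f (a(x := y)))"
    unfolding PiE_insert_eq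
    by (subst sum.reindex[OF inj_combinator[OF assms]]) (simp add: case_prod_unfold)
  then show ?thesis
    by (simp add: sum.cartesian_product)
qed

lemma sum_PiE_Un:
  fixes f g :: "_ \<Rightarrow> 'b :: comm_semiring_1"
  assumes "finite A" "A \<inter> B = {}"
    and f: "\<And>a a'. (\<And>x. x \<in> A \<Longrightarrow> a x = a' x) \<Longrightarrow> f a = f a'"
    and g: "\<And>a a'. (\<And>x. x \<in> B \<Longrightarrow> a x = a' x) \<Longrightarrow> g a = g a'"
  shows "(\<Sum>a\<in>A \<union> B \<rightarrow>\<^sub>E S. f a * g a) = (\<Sum>a\<in>A \<rightarrow>\<^sub>E S. f a) * (\<Sum>a\<in>B \<rightarrow>\<^sub>E S. g a)"
  using assms
proof (induction A arbitrary: f rule: finite_induct)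
  case empty
  \<comment> \<open>With \<open>A\<close> empty, the locality assumption on \<open>f\<close> says
    that \<open>f\<close> is constant; \<open>undefined\<close> is merely a point at which to name
    its value.\<close>
  then have "f = (\<lambda>_. f (\<lambda>_. undefined))"
    by blast
  then obtain c where "f = (\<lambda>_. c)"
    by metis
  then show ?case
    by (simp add: sum_distrib_left)
next
  case (insert x A)
  have g_upd: "g (a(x := y)) = g a" for a y
    by (rule insert.prems(3)) (use insert.prems(1) in auto)
  have "(\<Sum>a\<in>insert x A \<union> B \<rightarrow>\<^sub>E S. f a * g a) = (\<Sum>y\<in>S. \<Sum>a\<in>A \<union> B \<rightarrow>\<^sub>E S. f (a(x := y)) * g a)"
    using insert.hyps(2) insert.prems(1) by (simp add: sum_PiE_insert g_upd)
  also have "\<dots> = (\<Sum>y\<in>S. (\<Sum>a\<in>A \<rightarrow>\<^sub>E S. f (a(x := y))) * (\<Sum>a\<in>B \<rightarrow>\<^sub>E S. g a))"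
  proof (rule sum.cong[OF refl])
    fix y
    show "(\<Sum>a\<in>A \<union> B \<rightarrow>\<^sub>E S. f (a(x := y)) * g a) =
        (\<Sum>a\<in>A \<rightarrow>\<^sub>E S. f (a(x := y))) * (\<Sum>a\<in>B \<rightarrow>\<^sub>E S. g a)"
    proof (rule insert.IH)
      show "A \<inter> B = {}"
        using insert.prems(1) by simp
      show "f (a(x := y)) = f (a'(x := y))" if "\<And>z. z \<in> A \<Longrightarrow> a z = a' z" for a a'
        by (rule insert.prems(2)) (use that in auto)
    qed (rule insert.prems(3))
  qed
  also have "\<dots> = (\<Sum>a\<in>insert x A \<rightarrow>\<^sub>E S. f a) * (\<Sum>a\<in>B \<rightarrow>\<^sub>E S. g a)"
    using insert.hyps by (simp add: sum_PiE_insert sum_distrib_right)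
  finally show ?case .
qed

text \<open>Both sets are invariant under \<open>\<tau>\<close>, so no factor mixes indices from
  \<open>A\<close> with indices from \<open>B\<close>.\<close>

lemma cyc_sum_Un:
  assumes "finite A" "finite B" "A \<inter> B = {}" "\<tau> ` A \<subseteq> A" "\<tau> ` B \<subseteq> B"
  shows "cyc_sum (A \<union> B) \<tau> N = cyc_sum A \<tau> N * cyc_sum B \<tau> N"
  unfolding cyc_sum_def prod.union_disjoint[OF assms(1-3)]
  by (rule sum_PiE_Un) (use assms in \<open>auto intro!: prod.cong simp: image_subset_iff\<close>)

text \<open>Relabelling along \<open>h\<close>; it will move the conjugate trace from
  \<open>{1..j}\<close> to \<open>{j + 1..2 * j}\<close>.\<close>

lemma cyc_sum_reindex:
  fixes N :: "_ \<Rightarrow> complex^'n^'n"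
  assumes h: "bij_betw h A B" and \<tau>: "\<tau> ` A \<subseteq> A" "\<And>x. x \<in> A \<Longrightarrow> \<tau>' (h x) = h (\<tau> x)"
  shows "cyc_sum B \<tau>' N = cyc_sum A \<tau> (N \<circ> h)"
proof -
  let ?i = "the_inv_into A h"
  have inj: "inj_on h A" and im: "h ` A = B"
    using h by (auto simp: bij_betw_def)
  have B: "?i y \<in> A" "h (?i y) = y" if "y \<in> B" for y
    using that inj im by (auto simp: the_inv_into_into f_the_inv_into_f)
  have A: "?i (h x) = x" "h x \<in> B" if "x \<in> A" for x
    using that inj im by (auto simp: the_inv_into_f_f)
  show ?thesis
    unfolding cyc_sum_def
  proof (rule sum.reindex_bij_witness[where i = "\<lambda>a. restrict (a \<circ> ?i) B" and j = "\<lambda>b. restrict (b \<circ> h) A"])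
    fix b assume b: "b \<in> B \<rightarrow>\<^sub>E (UNIV :: 'n set)"
    show "restrict (restrict (b \<circ> h) A \<circ> ?i) B = b"
      using b by (auto simp: fun_eq_iff B restrict_def PiE_def extensional_def)
    show "restrict (b \<circ> h) A \<in> A \<rightarrow>\<^sub>E UNIV"
      by auto
    have "(\<Prod>w\<in>B. N w $ b w $ b (\<tau>' w)) = (\<Prod>w\<in>A. N (h w) $ b (h w) $ b (\<tau>' (h w)))"
      by (rule prod.reindex_bij_betw[OF h, symmetric])
    also have "\<dots> = (\<Prod>w\<in>A. (N \<circ> h) w $ restrict (b \<circ> h) A w $ restrict (b \<circ> h) A (\<tau> w))"
      using \<tau> by (intro prod.cong) auto
    finally show "(\<Prod>w\<in>A. (N \<circ> h) w $ restrict (b \<circ> h) A w $ restrict (b \<circ> h) A (\<tau> w)) =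
        (\<Prod>w\<in>B. N w $ b w $ b (\<tau>' w))" ..
  next
    fix a assume a: "a \<in> A \<rightarrow>\<^sub>E (UNIV :: 'n set)"
    show "restrict (restrict (a \<circ> ?i) B \<circ> h) A = a"
      using a by (auto simp: fun_eq_iff A restrict_def PiE_def extensional_def)
    show "restrict (a \<circ> ?i) B \<in> B \<rightarrow>\<^sub>E UNIV"
      by auto
  qed
qed

text \<open>Distributivity turns the inner indices of the matrix products into a second index
  function \<open>b\<close>. This is what separates the entries of \<open>H\<close> from those of
  the powers of \<open>U\<close>.\<close>

lemma cyc_sum_mult:
  assumes "finite W"
  shows "cyc_sum W \<tau> (\<lambda>w. P w ** Q w) =
    (\<Sum>a\<in>W \<rightarrow>\<^sub>E UNIV. \<Sum>b\<in>W \<rightarrow>\<^sub>E UNIV. \<Prod>w\<in>W. P w $ a w $ b w * Q w $ b w $ a (\<tau> w))"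
  using assms by (simp add: cyc_sum_def matrix_matrix_mult_def prod_sum_PiE)

text \<open>Conjugation reverses the word; since the factors \<open>H\<close> stay in front, the other factors move
  to the neighbouring position.\<close>

lemma cnj_cyc_sum:
  assumes W: "finite W" "\<tau> permutes W" and H: "conj_transpose H = H"
  shows "cnj (cyc_sum W \<tau> (\<lambda>w. H ** P w)) =
    cyc_sum W (inv \<tau>) (\<lambda>w. H ** conj_transpose (P (inv \<tau> w)))"
proof -
  have H': "cnj (H $ x $ y) = H $ y $ x" for x y
    using arg_cong[OF H, of "\<lambda>A. A $ y $ x"] by (simp add: conj_transpose_def)
  have "cnj (\<Prod>w\<in>W. H $ a w $ b w * P w $ b w $ a (\<tau> w)) =
      (\<Prod>w\<in>W. H $ b w $ a w * conj_transpose (P (inv \<tau> w)) $ a w $ b (inv \<tau> w))" for a b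
  proof -
    have "cnj (\<Prod>w\<in>W. H $ a w $ b w * P w $ b w $ a (\<tau> w)) =
        (\<Prod>w\<in>W. H $ b w $ a w) * (\<Prod>w\<in>W. conj_transpose (P w) $ a (\<tau> w) $ b w)"
      by (simp add: prod.distrib H' conj_transpose_def)
    also have "(\<Prod>w\<in>W. conj_transpose (P w) $ a (\<tau> w) $ b w) =
        (\<Prod>w\<in>W. conj_transpose (P (inv \<tau> w)) $ a w $ b (inv \<tau> w))"
      using W by (subst prod.permute[OF W(2)]) (simp add: o_def permutes_inverses)
    finally show ?thesis
      by (simp add: prod.distrib)
  qed
  then have "cnj (cyc_sum W \<tau> (\<lambda>w. H ** P w)) = (\<Sum>a\<in>W \<rightarrow>\<^sub>E UNIV. \<Sum>b\<in>W \<rightarrow>\<^sub>E UNIV.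
      \<Prod>w\<in>W. H $ b w $ a w * conj_transpose (P (inv \<tau> w)) $ a w $ b (inv \<tau> w))"
    unfolding cyc_sum_mult[OF W(1)] cnj_sum by simp
  \<comment> \<open>In the reversed word the former inner index \<open>b\<close> is the row index of
    \<open>H\<close>, so the two index functions exchange roles.\<close>
  also have "\<dots> = cyc_sum W (inv \<tau>) (\<lambda>w. H ** conj_transpose (P (inv \<tau> w)))"
    unfolding cyc_sum_mult[OF W(1)] by (rule sum.swap)
  finally show ?thesis .
qed

text \<open>The weight \<open>g\<close> on the first index serves to close the path into a cycle.\<close>

lemma mat_word_nth:
  fixes A B :: "complex^'n^'n"
  shows "(\<Sum>x\<in>UNIV. g x * mat_word A B s k $ x $ y) =
    (\<Sum>c\<in>{1..k} \<rightarrow>\<^sub>E UNIV. g ((c(Suc k := y)) 1) *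
      (\<Prod>l\<in>{1..k}. (A ** mat_pow B (s l)) $ c l $ (c(Suc k := y)) (Suc l)))"
proof (induction k arbitrary: y)
  case 0
  show ?case by (simp add: mat_def if_distrib[of "(*) _"] cong: if_cong)
next
  case (Suc k)
  let ?Q = "\<lambda>l. A ** mat_pow B (s l)"
  have "(\<Sum>x\<in>UNIV. g x * mat_word A B s (Suc k) $ x $ y) =
      (\<Sum>x\<in>UNIV. \<Sum>z\<in>UNIV. g x * mat_word A B s k $ x $ z * ?Q (Suc k) $ z $ y)"
    by (simp add: matrix_matrix_mult_def[of "mat_word A B s k"] sum_distrib_left mult.assoc)
  also have "\<dots> = (\<Sum>z\<in>UNIV. (\<Sum>x\<in>UNIV. g x * mat_word A B s k $ x $ z) * ?Q (Suc k) $ z $ y)"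
    by (subst sum.swap) (simp add: sum_distrib_right)
  also have "\<dots> = (\<Sum>z\<in>UNIV. \<Sum>c\<in>{1..k} \<rightarrow>\<^sub>E UNIV. g ((c(Suc k := z)) 1) *
      (\<Prod>l\<in>{1..k}. ?Q l $ c l $ (c(Suc k := z)) (Suc l)) * ?Q (Suc k) $ z $ y)"
    unfolding Suc.IH by (simp add: sum_distrib_right)
  \<comment> \<open>The old end point \<open>z\<close> becomes the inner vertex \<open>Suc k\<close>
    and \<open>y\<close> the new end point; the second update is invisible to the earlier
    factors.\<close>
  also have "\<dots> = (\<Sum>z\<in>UNIV. \<Sum>c\<in>{1..k} \<rightarrow>\<^sub>E UNIV. g ((c(Suc k := z, Suc (Suc k) := y)) 1) *
      (\<Prod>l\<in>insert (Suc k) {1..k}. ?Q l $ (c(Suc k := z)) l $ (c(Suc k := z, Suc (Suc k) := y)) (Suc l)))"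
  proof (intro sum.cong refl)
    fix z c
    have "(\<Prod>l\<in>{1..k}. ?Q l $ (c(Suc k := z)) l $ (c(Suc k := z, Suc (Suc k) := y)) (Suc l)) =
        (\<Prod>l\<in>{1..k}. ?Q l $ c l $ (c(Suc k := z)) (Suc l))"
      by (rule prod.cong) auto
    then show "g ((c(Suc k := z)) 1) * (\<Prod>l\<in>{1..k}. ?Q l $ c l $ (c(Suc k := z)) (Suc l)) *
        ?Q (Suc k) $ z $ y = g ((c(Suc k := z, Suc (Suc k) := y)) 1) *
        (\<Prod>l\<in>insert (Suc k) {1..k}. ?Q l $ (c(Suc k := z)) l $
          (c(Suc k := z, Suc (Suc k) := y)) (Suc l))"
      by (subst prod.insert) (simp_all add: mult_ac)
  qed
  also have "\<dots> = (\<Sum>c\<in>insert (Suc k) {1..k} \<rightarrow>\<^sub>E UNIV. g ((c(Suc (Suc k) := y)) 1) *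
      (\<Prod>l\<in>insert (Suc k) {1..k}. ?Q l $ c l $ (c(Suc (Suc k) := y)) (Suc l)))"
    by (subst sum_PiE_insert) simp_all
  also have "insert (Suc k) {1..k} = {1..Suc k}"
    by auto
  finally show ?case .
qed

lemma trace_mat_word:
  assumes j: "j \<ge> 1"
  shows "trace (mat_word A B s j) =
    cyc_sum {1..j} (\<lambda>l. if l < j then Suc l else 1) (\<lambda>l. A ** mat_pow B (s l))"
proof -
  obtain k where j: "j = Suc k"
    using j by (cases j) auto
  let ?Q = "\<lambda>l. A ** mat_pow B (s l)"
  \<comment> \<open>Only the last factor is split off: its entry from \<open>y\<close> back to
    \<open>x\<close> is the weight \<open>g\<close> with which \<open>mat_word_nth\<close> is
    applied.\<close>
  have "trace (mat_word A B s j) = (\<Sum>x\<in>UNIV. \<Sum>y\<in>UNIV. ?Q j $ y $ x * mat_word A B s k $ x $ y)"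
    by (simp add: trace_def j matrix_matrix_mult_def[of "mat_word A B s k"] mult.commute)
  also have "\<dots> = (\<Sum>y\<in>UNIV. \<Sum>c\<in>{1..k} \<rightarrow>\<^sub>E UNIV. ?Q j $ y $ (c(Suc k := y)) 1 *
      (\<Prod>l\<in>{1..k}. ?Q l $ c l $ (c(Suc k := y)) (Suc l)))"
    by (subst sum.swap) (intro sum.cong refl mat_word_nth)
  also have "\<dots> = (\<Sum>c\<in>insert (Suc k) {1..k} \<rightarrow>\<^sub>E UNIV.
      \<Prod>l\<in>insert (Suc k) {1..k}. ?Q l $ c l $ c (if l < j then Suc l else 1))"
  proof (subst sum_PiE_insert, simp, intro sum.cong refl)
    fix z c
    have "(\<Prod>l\<in>{1..k}. ?Q l $ (c(Suc k := z)) l $ (c(Suc k := z)) (if l < j then Suc l else 1)) =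
        (\<Prod>l\<in>{1..k}. ?Q l $ c l $ (c(Suc k := z)) (Suc l))"
      by (rule prod.cong) (auto simp: j)
    then show "?Q j $ z $ (c(Suc k := z)) 1 * (\<Prod>l\<in>{1..k}. ?Q l $ c l $ (c(Suc k := z)) (Suc l)) =
        (\<Prod>l\<in>insert (Suc k) {1..k}. ?Q l $ (c(Suc k := z)) l $
          (c(Suc k := z)) (if l < j then Suc l else 1))"
      by (subst prod.insert) (simp_all add: j)
  qed
  also have "insert (Suc k) {1..k} = {1..j}"
    by (auto simp: j)
  finally show ?thesis
    by (simp add: cyc_sum_def)
qed

section \<open>Evaluation of index sums by contracting cycles\<close>

lemma cyc_sum_fixpoint:
  assumes "finite W" "w \<notin> W" "\<tau> w = w" "\<tau> ` W \<subseteq> W"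
  shows "cyc_sum (insert w W) \<tau> N = trace (N w) * cyc_sum W \<tau> N"
proof -
  have "cyc_sum ({w} \<union> W) \<tau> N = cyc_sum {w} \<tau> N * cyc_sum W \<tau> N"
    by (rule cyc_sum_Un) (use assms in auto)
  moreover have "cyc_sum {w} \<tau> N = trace (N w)"
    using assms by (simp add: cyc_sum_def sum_PiE_insert trace_def)
  ultimately show ?thesis
    by simp
qed

text \<open>Summing over the value of \<open>a\<close> at \<open>w\<close> merges \<open>w\<close> into its predecessor \<open>u\<close>.\<close>

lemma cyc_sum_contract:
  assumes W: "finite W" "w \<notin> W" "u \<in> W" and \<tau>: "inj \<tau>" "\<tau> u = w"
  shows "cyc_sum (insert w W) \<tau> N =
    cyc_sum W (\<tau> \<circ> Transposition.transpose u w) (N(u := N u ** N w))"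
proof -
  let ?\<tau>' = "\<tau> \<circ> Transposition.transpose u w"
  have neq: "u \<noteq> w"
    using W by auto
  have \<tau>w: "\<tau> w \<noteq> w"
    using neq \<tau> injD by metis
  \<comment> \<open>Injectivity makes \<open>u\<close> the only predecessor of \<open>w\<close>;
    hence the value \<open>y\<close> at \<open>w\<close> enters only the factors of \<open>u\<close>
    and \<open>w\<close>.\<close>
  have \<tau>': "?\<tau>' u = \<tau> w" "\<And>v. v \<in> W - {u} \<Longrightarrow> ?\<tau>' v = \<tau> v" "\<And>v. v \<in> W - {u} \<Longrightarrow> \<tau> v \<noteq> w"
    using W \<tau> by (auto simp: Transposition.transpose_def dest: injD)
  have "cyc_sum (insert w W) \<tau> N = (\<Sum>y\<in>UNIV. \<Sum>a\<in>W \<rightarrow>\<^sub>E UNIV.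
      \<Prod>v\<in>insert w W. N v $ (a(w := y)) v $ (a(w := y)) (\<tau> v))"
    using W by (simp add: cyc_sum_def sum_PiE_insert)
  also have "\<dots> = (\<Sum>y\<in>UNIV. \<Sum>a\<in>W \<rightarrow>\<^sub>E UNIV. N u $ a u $ y * N w $ y $ a (\<tau> w) *
      (\<Prod>v\<in>W - {u}. N v $ a v $ a (\<tau> v)))"
  proof (intro sum.cong refl)
    fix y a
    have "(\<Prod>v\<in>W. N v $ (a(w := y)) v $ (a(w := y)) (\<tau> v)) = N u $ a u $ y *
        (\<Prod>v\<in>W - {u}. N v $ (a(w := y)) v $ (a(w := y)) (\<tau> v))"
      by (subst prod.remove[OF W(1,3)]) (simp add: \<tau> neq)
    also have "(\<Prod>v\<in>W - {u}. N v $ (a(w := y)) v $ (a(w := y)) (\<tau> v)) =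
        (\<Prod>v\<in>W - {u}. N v $ a v $ a (\<tau> v))"
      using W(2) \<tau>'(3) by (intro prod.cong refl) auto
    finally show "(\<Prod>v\<in>insert w W. N v $ (a(w := y)) v $ (a(w := y)) (\<tau> v)) =
        N u $ a u $ y * N w $ y $ a (\<tau> w) * (\<Prod>v\<in>W - {u}. N v $ a v $ a (\<tau> v))"
      using W(1,2) \<tau>w by (simp add: mult_ac)
  qed
  also have "\<dots> = (\<Sum>a\<in>W \<rightarrow>\<^sub>E UNIV. (N u ** N w) $ a u $ a (\<tau> w) *
      (\<Prod>v\<in>W - {u}. N v $ a v $ a (\<tau> v)))"
    by (subst sum.swap) (simp add: matrix_matrix_mult_def sum_distrib_right)
  also have "\<dots> = cyc_sum W ?\<tau>' (N(u := N u ** N w))"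
    unfolding cyc_sum_def
  proof (intro sum.cong refl)
    fix a
    have "(\<Prod>v\<in>W - {u}. N v $ a v $ a (\<tau> v)) =
        (\<Prod>v\<in>W - {u}. (N(u := N u ** N w)) v $ a v $ a (?\<tau>' v))"
      by (intro prod.cong refl) (use \<tau>'(2) in auto)
    then show "(N u ** N w) $ a u $ a (\<tau> w) * (\<Prod>v\<in>W - {u}. N v $ a v $ a (\<tau> v)) =
        (\<Prod>v\<in>W. (N(u := N u ** N w)) v $ a v $ a (?\<tau>' v))"
      by (subst prod.remove[OF W(1,3)]) (simp only: \<tau>'(1) fun_upd_same)
  qed
  finally show ?thesis .
qed

text \<open>Composing with the transposition makes \<open>w\<close> a fixed point and sends
  \<open>u\<close> straight to \<open>\<tau> w\<close>: the point \<open>w\<close> is cut out of its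
  cycle and nothing else changes.\<close>

lemma orbit_contract:
  assumes perm: "permutation \<tau>" and \<tau>: "\<tau> u = w" "u \<noteq> w" and x: "x \<noteq> w"
  shows "orbit (\<tau> \<circ> Transposition.transpose u w) x = orbit \<tau> x - {w}"
proof -
  define \<tau>' where "\<tau>' = \<tau> \<circ> Transposition.transpose u w"
  have perm': "permutation \<tau>'"
    unfolding \<tau>'_def using perm by (intro permutation_compose permutation_swap_id)
  have \<tau>': "\<tau>' w = w" "\<tau>' u = \<tau> w" "\<And>v. v \<noteq> u \<Longrightarrow> v \<noteq> w \<Longrightarrow> \<tau>' v = \<tau> v"
    using \<tau> by (auto simp: \<tau>'_def Transposition.transpose_def)
  have w: "w \<notin> orbit \<tau>' x"
  proof
    assume "w \<in> orbit \<tau>' x"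
    then have "x \<in> orbit \<tau>' w"
      by (rule orbit_swap[OF permutation_self_in_orbit[OF perm']])
    also have "orbit \<tau>' w = {w}"
      using \<tau>'(1) by (simp only: orbit_eq_singleton_iff)
    finally show False
      using x by simp
  qed
  have "y \<in> orbit \<tau> x" if "y \<in> orbit \<tau>' x" for y
    using that
  proof induction
    case base
    show ?case
      using x \<tau> by (cases "x = u") (auto simp: \<tau>' intro: orbit.intros)
  next
    case (step y)
    then have "y \<noteq> w"
      using w by auto
    then show ?case
      using step \<tau> \<tau>' by (cases "y = u") (auto simp: \<tau>' intro: orbit.intros)
  qed
  \<comment> \<open>The orbit of \<open>\<tau>\<close> may visit \<open>w\<close>, which
    \<open>\<tau>'\<close> skips; for that moment the invariant records that \<open>\<tau>'\<close>
    has reached the predecessor \<open>u\<close>.\<close>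
  moreover have "(y \<noteq> w \<longrightarrow> y \<in> orbit \<tau>' x) \<and> (y = w \<longrightarrow> u \<in> orbit \<tau>' x)" if "y \<in> orbit \<tau> x" for y
    using that
  proof induction
    case base
    show ?case
    proof (cases "x = u")
      case True
      then show ?thesis
        using \<tau> permutation_self_in_orbit[OF perm', of u] by simp
    next
      case False
      then have "\<tau> x \<noteq> w"
        using \<tau>(1) injD[OF bij_is_inj[OF permutation_bijective[OF perm]]] by metis
      then show ?thesis
        using \<tau>'(3)[OF False x] orbit.base[of \<tau>' x] by simp
    qed
  next
    case (step y)
    have inj: "\<tau> y = w \<longleftrightarrow> y = u" for y
      using \<tau>(1) injD[OF bij_is_inj[OF permutation_bijective[OF perm]]] by metis
    consider "y = w" | "y = u" | "y \<noteq> w" "y \<noteq> u"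
      by blast
    then show ?case
    proof cases
      case 1
      then have "\<tau>' u \<in> orbit \<tau>' x"
        using step.IH by (intro orbit.step) simp
      then show ?thesis
        using 1 \<tau>'(2) \<tau>(2) inj by simp
    next
      case 2
      then show ?thesis
        using step.IH \<tau> by simp
    next
      case 3
      then have "\<tau>' y \<in> orbit \<tau>' x"
        using step.IH by (intro orbit.step) simp
      then show ?thesis
        using 3 \<tau>'(3) inj by simp
    qed
  qed
  ultimately show ?thesis
    using w unfolding \<tau>'_def[symmetric] by blast
qed

lemma orbit_eq_of_mem:
  assumes "permutation f" "y \<in> orbit f x"
  shows "orbit f y = orbit f x"
  using orbit_cyclic_eq3[OF cyclic_on_orbit'[OF assms(1)] assms(2)] .

text \<open>Induction on the index set: a fixed point splits off a trace, and any other point is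
  merged into its predecessor, whose exponent absorbs its own. Since both change at each
  contraction, \<open>\<tau>\<close> and \<open>e\<close> are kept arbitrary.\<close>

lemma cyc_sum_mat_powi:
  assumes U: "U \<in> unitary_matrices" and "finite W" "\<tau> permutes W"
  shows "cyc_sum W \<tau> (\<lambda>w. mat_powi U (e w)) = (\<Prod>o'\<in>orbit \<tau> ` W. trace (mat_powi U (\<Sum>w\<in>o'. e w)))"
  using assms(2,3)
proof (induction W arbitrary: \<tau> e rule: finite_induct)
  case empty
  show ?case by simp
next
  case (insert w W)
  have perm: "permutation \<tau>"
    using insert.prems insert.hyps(1) by (auto simp: permutation_permutes)
  have inj: "inj \<tau>"
    using insert.prems by (rule permutes_inj)
  show ?case
  proof (cases "\<tau> w = w")
    case True
    then have W: "\<tau> permutes W"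
      by (intro permutes_superset[OF insert.prems]) auto
    have orb: "orbit \<tau> w = {w}"
      using True by (simp add: orbit_eq_singleton_iff)
    have "orbit \<tau> x \<subseteq> W" if "x \<in> W" for x
      using that by (rule permutes_orbit_subset[OF W])
    \<comment> \<open>The product runs over a set of orbits, so the new factor counts separately
      only because \<open>{w}\<close> is a new orbit.\<close>
    then have "{w} \<notin> orbit \<tau> ` W"
      using insert.hyps(2) by auto
    then show ?thesis
      using insert.hyps insert.IH[OF W] True permutes_image[OF W] by (simp add: cyc_sum_fixpoint orb)
  next
    case False
    define u where "u = inv \<tau> w"
    have "\<tau> u = w"
      using insert.prems by (simp add: u_def permutes_inverses)
    then have u: "\<tau> u = w" "u \<noteq> w"
      using False by auto
    have uW: "u \<in> W"
      using u insert.prems permutes_in_image[OF insert.prems, of u] by auto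
    define \<tau>' where "\<tau>' = \<tau> \<circ> Transposition.transpose u w"
    define e' where "e' = e(u := e u + e w)"
    have "\<tau>' permutes insert w W"
      unfolding \<tau>'_def using insert.prems uW by (intro permutes_compose permutes_swap_id) auto
    moreover have "\<tau>' w = w"
      using u by (simp add: \<tau>'_def)
    ultimately have W: "\<tau>' permutes W"
      by (elim permutes_superset) auto
    have orb: "orbit \<tau>' x = orbit \<tau> x - {w}" if "x \<in> W" for x
      unfolding \<tau>'_def using perm u that insert.hyps(2) by (intro orbit_contract) auto
    have uw: "orbit \<tau> w = orbit \<tau> u"
      using permutation_orbit_step[OF perm, of u] u by simp
    \<comment> \<open>Since \<open>u\<close> and \<open>w\<close> share their orbit, moving the
      exponent from \<open>w\<close> to \<open>u\<close> changes no orbit sum.\<close>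
    have sum_e: "(\<Sum>v\<in>orbit \<tau> x - {w}. e' v) = (\<Sum>v\<in>orbit \<tau> x. e v)" for x
    proof -
      have fin: "finite (orbit \<tau> x)"
        by (rule finite_orbit[OF permutation_self_in_orbit[OF perm]])
      have "w \<in> orbit \<tau> x \<longleftrightarrow> u \<in> orbit \<tau> x"
        using u orbit_eq_of_mem[OF perm] uw permutation_self_in_orbit[OF perm]
        by (metis orbit.step)
      then show ?thesis
        using fin u(2)
        by (cases "w \<in> orbit \<tau> x")
          (auto simp: e'_def sum.remove[of "orbit \<tau> x" w] sum.remove[of "orbit \<tau> x - {w}" u]
            intro!: sum.cong)
    qed
    \<comment> \<open>Deleting \<open>w\<close> cannot merge two orbits: each of them contains a
      point of \<open>W\<close>, which survives the deletion and determines the orbit.\<close>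
    have inj_on: "inj_on (\<lambda>o'. o' - {w}) (orbit \<tau> ` W)"
    proof (rule inj_onI, elim imageE)
      fix o1 o2 x y
      assume *: "o1 - {w} = o2 - {w}" "o1 = orbit \<tau> x" "x \<in> W" "o2 = orbit \<tau> y" "y \<in> W"
      then have "x \<in> orbit \<tau> y"
        using permutation_self_in_orbit[OF perm, of x] insert.hyps(2) by auto
      then show "o1 = o2"
        using * orbit_eq_of_mem[OF perm] by simp
    qed
    have "(\<lambda>w. mat_powi U (e w))(u := mat_powi U (e u) ** mat_powi U (e w)) = (\<lambda>w. mat_powi U (e' w))"
      by (simp add: fun_eq_iff e'_def mat_powi_add[OF U])
    then have "cyc_sum (insert w W) \<tau> (\<lambda>w. mat_powi U (e w)) = cyc_sum W \<tau>' (\<lambda>w. mat_powi U (e' w))"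
      using cyc_sum_contract[OF insert.hyps uW inj u(1), of "\<lambda>w. mat_powi U (e w)"]
      by (simp add: \<tau>'_def)
    also have "\<dots> = (\<Prod>o'\<in>orbit \<tau>' ` W. trace (mat_powi U (\<Sum>w\<in>o'. e' w)))"
      by (rule insert.IH[OF W])
    also have "orbit \<tau>' ` W = (\<lambda>o'. o' - {w}) ` orbit \<tau> ` W"
      unfolding image_image using orb by (intro image_cong) auto
    also have "(\<Prod>o'\<in>(\<lambda>o'. o' - {w}) ` orbit \<tau> ` W. trace (mat_powi U (\<Sum>w\<in>o'. e' w))) =
        (\<Prod>o'\<in>orbit \<tau> ` W. trace (mat_powi U (\<Sum>w\<in>o'. e w)))"
      by (subst prod.reindex[OF inj_on], intro prod.cong) (auto simp: sum_e)
    also have "orbit \<tau> ` W = orbit \<tau> ` insert w W"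
      using uw uW by auto
    finally show ?thesis .
  qed
qed

section \<open>The permutation of the even numbers\<close>

text \<open>On even numbers \<open>\<rho>\<close> acts as \<open>2 l \<mapsto> 2 r(l) - 1\<close>, where \<open>r\<close> is the following permutation of
  \<open>{1..2 j}\<close>; hence \<open>\<pi>~ \<rho>\<close> acts as \<open>2 l \<mapsto> 2 \<pi>(r(l))\<close>.\<close>

definition half_rho :: "nat \<Rightarrow> nat \<Rightarrow> nat" where
  "half_rho j l =
     (if l \<in> {1..<j} then l + 1 else if l = j then 1
      else if l = j + 1 then 2 * j else if l \<in> {j + 2..2 * j} then l - 1 else l)"

text \<open>The fold in \<open>rho\<close> for an arbitrary list, a form that admits
  induction.\<close>

definition transpositions :: "('b \<times> 'b) list \<Rightarrow> 'b \<Rightarrow> 'b" where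
  "transpositions ps = foldr (\<lambda>(a, b) f. Transposition.transpose a b \<circ> f) ps id"

lemma transpositions_Nil [simp]: "transpositions [] x = x"
  and transpositions_Cons [simp]:
    "transpositions ((a, b) # ps) x = Transposition.transpose a b (transpositions ps x)"
  by (simp_all add: transpositions_def)

lemma transpositions_notin:
  "x \<notin> fst ` set ps \<Longrightarrow> x \<notin> snd ` set ps \<Longrightarrow> transpositions ps x = x"
  by (induction ps) auto

text \<open>With all entries distinct, a single transposition of the list moves a given point, and
  the others fix both the point and its image.\<close>

lemma transpositions_disjoint:
  assumes "distinct (map fst ps @ map snd ps)" "(a, b) \<in> set ps"
  shows "transpositions ps a = b" "transpositions ps b = a"
proof -
  have "transpositions ps a = b \<and> transpositions ps b = a"
    using assms
  proof (induction ps)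
    case (Cons p ps)
    obtain c d where p: "p = (c, d)"
      by fastforce
    show ?case
    proof (cases "(a, b) = p")
      case True
      then have "a \<notin> fst ` set ps" "a \<notin> snd ` set ps" "b \<notin> fst ` set ps" "b \<notin> snd ` set ps"
        using Cons.prems(1) by (simp_all add: True[symmetric])
      then have "transpositions ps a = a" "transpositions ps b = b"
        by (simp_all add: transpositions_notin)
      then show ?thesis
        by (simp add: True[symmetric])
    next
      case False
      then have "(a, b) \<in> set ps"
        using Cons.prems by auto
      then have "transpositions ps a = b" "transpositions ps b = a"
          "a \<in> fst ` set ps" "b \<in> snd ` set ps"
        using Cons by (force simp: image_iff)+
      moreover from this have "a \<noteq> c" "a \<noteq> d" "b \<noteq> c" "b \<noteq> d"
        using Cons.prems(1) by (auto simp: p)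
      ultimately show ?thesis
        by (simp add: p)
    qed
  qed simp
  then show "transpositions ps a = b" "transpositions ps b = a"
    by blast+
qed

lemma rho_even:
  assumes "l \<in> {1..2 * j}"
  shows "rho j (2 * l) = 2 * half_rho j l - 1"
proof -
  define ps where "ps = map (\<lambda>l. (2 * l, 2 * l + 1)) [1..<j] @ [(2 * j, 1)] @
        map (\<lambda>l. (2 * j + 2 * l - 1, 2 * j + 2 * l + 2)) [1..<j] @ [(4 * j - 1, 2 * j + 2)]"
  have rho: "rho j = transpositions ps"
    by (simp add: rho_def ps_def transpositions_def)
  have fst: "map fst ps = map (\<lambda>l. 2 * l) [1..<j] @ [2 * j] @
      map (\<lambda>l. 2 * j + 2 * l - 1) [1..<j] @ [4 * j - 1]"
    and snd: "map snd ps = map (\<lambda>l. 2 * l + 1) [1..<j] @ [1] @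
      map (\<lambda>l. 2 * j + 2 * l + 2) [1..<j] @ [2 * j + 2]"
    by (simp_all add: ps_def)
  have "distinct (map fst ps)" "distinct (map snd ps)"
    unfolding fst snd using assms by (auto simp: distinct_map inj_on_def; presburger)+
  \<comment> \<open>Even first components are at most \<open>2 * j\<close> and even second ones
    larger; for odd components it is the other way round.\<close>
  moreover have "set (map fst ps) \<inter> set (map snd ps) = {}"
    unfolding fst snd using assms by (auto; presburger)
  ultimately have dist: "distinct (map fst ps @ map snd ps)"
    by simp
  \<comment> \<open>Here \<open>k\<close> numbers the transposition within the third block of
    \<open>rho\<close>. In the second half the even number is the second component of its
    pair.\<close>
  consider "l < j" | "l = j" | "l = j + 1" | k where "k \<in> {1..<j}" "l = j + k + 1"
    using assms that(4)[of "l - j - 1"] by force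
  then show ?thesis
  proof cases
    case 1
    then have "(2 * l, 2 * l + 1) \<in> set ps"
      using assms by (auto simp: ps_def)
    then show ?thesis
      using transpositions_disjoint(1)[OF dist] 1 assms by (simp add: rho half_rho_def)
  next
    case 2
    then have "(2 * l, 1) \<in> set ps"
      by (simp add: ps_def)
    then show ?thesis
      using transpositions_disjoint(1)[OF dist] 2 assms by (simp add: rho half_rho_def)
  next
    case 3
    then have "(4 * j - 1, 2 * l) \<in> set ps"
      by (simp add: ps_def)
    then show ?thesis
      using transpositions_disjoint(2)[OF dist] 3 assms by (simp add: rho half_rho_def)
  next
    case 4
    then have "(2 * j + 2 * k - 1, 2 * l) \<in> set ps"
      by (auto simp: ps_def)
    then show ?thesis
      using transpositions_disjoint(2)[OF dist] 4 assms by (auto simp: rho half_rho_def)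
  qed
qed

lemma half_rho_permutes:
  assumes "j \<ge> 1"
  shows "half_rho j permutes {1..2 * j}"
proof (rule bij_imp_permutes)
  have "half_rho j ` {1..2 * j} \<subseteq> {1..2 * j}"
    using assms by (auto simp: half_rho_def)
  moreover have "inj_on (half_rho j) {1..2 * j}"
    \<comment> \<open>The inverse runs backwards through \<open>{1..j}\<close> and forwards through
      \<open>{j + 1..2 * j}\<close>, wrapping around in each block.\<close>
    by (rule inj_on_inverseI[where g = "\<lambda>l. if l = 1 then j else if l \<le> j then l - 1
          else if l < 2 * j then l + 1 else j + 1"])
      (auto simp: half_rho_def)
  ultimately show "bij_betw (half_rho j) {1..2 * j} {1..2 * j}"
    by (simp add: bij_betw_def endo_inj_surj)
  show "half_rho j l = l" if "l \<notin> {1..2 * j}" for l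
    using that assms by (auto simp: half_rho_def)
qed

text \<open>Doubling intertwines \<open>\<pi> \<circ> half_rho j\<close> with the composition on
  even numbers, hence carries orbits to orbits.\<close>

lemma even_orbits_eq:
  assumes j: "j \<ge> 1" and \<pi>: "\<pi> permutes {1..2 * j}"
  shows "even_orbits j \<pi> = (\<lambda>o'. (*) 2 ` o') ` orbit (\<pi> \<circ> half_rho j) ` {1..2 * j}"
proof -
  let ?\<tau> = "\<pi> \<circ> half_rho j"
  have \<tau>: "?\<tau> permutes {1..2 * j}"
    using permutes_compose[OF half_rho_permutes[OF j] \<pi>] .
  have step: "(doubled j \<pi> \<circ> rho j) (2 * l) = 2 * ?\<tau> l" if "l \<in> {1..2 * j}" for l
  proof -
    \<comment> \<open>The lower bound matters: for \<open>half_rho j l = 0\<close> the subtraction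
      in \<open>2 * half_rho j l - 1\<close> would be truncated.\<close>
    have r: "half_rho j l \<in> {1..2 * j}"
      using permutes_in_image[OF half_rho_permutes[OF j]] that by simp
    then have "odd (2 * half_rho j l - 1)" "(2 * half_rho j l - 1 + 1) div 2 = half_rho j l"
        "2 * half_rho j l - 1 \<in> {1..4 * j}"
      by auto
    then show ?thesis
      using that by (simp only: o_apply rho_even doubled_def if_True not_False_eq_True)
  qed
  have orb: "orbit (doubled j \<pi> \<circ> rho j) (2 * l) = (*) 2 ` orbit ?\<tau> l" if "l \<in> {1..2 * j}" for l
  proof (rule orbit_inverse[symmetric])
    show "l \<in> orbit ?\<tau> l"
      using \<tau> by (intro permutation_self_in_orbit) (auto simp: permutation_permutes)
    show "(doubled j \<pi> \<circ> rho j) (2 * x) = 2 * ?\<tau> x" if "x \<in> orbit ?\<tau> l" for x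
      using permutes_orbit_subset[OF \<tau> \<open>l \<in> {1..2 * j}\<close>] that by (intro step) auto
  qed
  have "w \<in> (*) 2 ` {1..2 * j}" if "w \<in> {1..4 * j}" "even w" for w
    using that by (auto elim!: evenE)
  then have evens: "{w \<in> {1..4 * j}. even w} = (*) 2 ` {1..2 * j}"
    by auto
  show ?thesis
    unfolding even_orbits_def evens image_image using orb by (intro image_cong) auto
qed

text \<open>Doubling is injective, so neither factors nor exponents coincide; then
  \<open>cyc_sum_mat_powi\<close> is read from right to left, back to an index sum.\<close>

lemma prod_even_orbits:
  assumes U: "U \<in> unitary_matrices" and j: "j \<ge> 1" and \<pi>: "\<pi> permutes {1..2 * j}"
  shows "(\<Prod>o'\<in>even_orbits j \<pi>. trace (mat_powi U (\<Sum>w\<in>o'. e w))) =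
    cyc_sum {1..2 * j} (\<pi> \<circ> half_rho j) (\<lambda>l. mat_powi U (e (2 * l)))"
proof -
  have "inj_on (\<lambda>o'. (*) 2 ` o') S" for S :: "nat set set"
    by (intro inj_onI) (simp add: inj_image_eq_iff inj_on_def)
  then have "(\<Prod>o'\<in>even_orbits j \<pi>. trace (mat_powi U (\<Sum>w\<in>o'. e w))) =
      (\<Prod>o'\<in>orbit (\<pi> \<circ> half_rho j) ` {1..2 * j}. trace (mat_powi U (\<Sum>w\<in>(*) 2 ` o'. e w)))"
    unfolding even_orbits_eq[OF j \<pi>] by (subst prod.reindex) simp_all
  also have "\<dots> = (\<Prod>o'\<in>orbit (\<pi> \<circ> half_rho j) ` {1..2 * j}. trace (mat_powi U (\<Sum>l\<in>o'. e (2 * l))))"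
    by (simp add: sum.reindex inj_on_def)
  also have "\<dots> = cyc_sum {1..2 * j} (\<pi> \<circ> half_rho j) (\<lambda>l. mat_powi U (e (2 * l)))"
    by (rule cyc_sum_mat_powi[OF U _ permutes_compose[OF half_rho_permutes[OF j] \<pi>], symmetric]) simp
  finally show ?thesis .
qed

text \<open>The trace occupies the indices up to \<open>j\<close> with a forward cycle, its
  conjugate those above \<open>j\<close> with the inverse cycle. This is where
  \<open>half_rho\<close> and \<open>sigma_hat\<close> come from.\<close>

lemma trace_mult_cnj_trace_mat_word:
  assumes H: "conj_transpose H = H" and U: "U \<in> unitary_matrices" and j: "j \<ge> 1"
  shows "trace (mat_word H U \<sigma> j) * cnj (trace (mat_word H U \<sigma> j)) =
    cyc_sum {1..2 * j} (half_rho j) (\<lambda>l. H ** mat_powi U (sigma_hat \<sigma> j (2 * l)))"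
proof -
  let ?N = "\<lambda>l. H ** mat_powi U (sigma_hat \<sigma> j (2 * l))"
  \<comment> \<open>\<open>c\<close> agrees with \<open>half_rho j\<close> on \<open>{1..j}\<close>
    but is the identity elsewhere, so that it permutes \<open>{1..j}\<close> and has an inverse
    there.\<close>
  define c where "c l = (if l \<in> {1..<j} then l + 1 else if l = j then 1 else l)" for l
  have c: "c permutes {1..j}"
  proof (rule bij_imp_permutes)
    have "c ` {1..j} \<subseteq> {1..j}"
      using j by (auto simp: c_def)
    moreover have "inj_on c {1..j}"
      by (rule inj_onI) (auto simp: c_def split: if_splits)
    ultimately show "bij_betw c {1..j} {1..j}"
      by (simp add: bij_betw_def endo_inj_surj)
    show "c l = l" if "l \<notin> {1..j}" for l
      using that j by (auto simp: c_def)
  qed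
  have inv_c: "inv c l = (if l = 1 then j else l - 1)" if "l \<in> {1..j}" for l
    using that by (subst permutes_inv_eq[OF c]) (auto simp: c_def)
  have tr: "trace (mat_word H U \<sigma> j) = cyc_sum {1..j} c (\<lambda>l. H ** mat_pow U (\<sigma> l))"
    unfolding trace_mat_word[OF j] by (rule cyc_sum_cong) (auto simp: c_def)
  also have "\<dots> = cyc_sum {1..j} (half_rho j) ?N"
    by (rule cyc_sum_cong) (auto simp: c_def half_rho_def sigma_hat_def)
  finally have 1: "trace (mat_word H U \<sigma> j) = cyc_sum {1..j} (half_rho j) ?N" .
  have "cnj (trace (mat_word H U \<sigma> j)) =
      cyc_sum {1..j} (inv c) (\<lambda>l. H ** conj_transpose (mat_pow U (\<sigma> (inv c l))))"
    unfolding tr by (rule cnj_cyc_sum[OF _ c H]) simp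
  \<comment> \<open>At \<open>l + j\<close> stands minus the exponent of the predecessor of
    \<open>l\<close>; for \<open>l = 1\<close> this predecessor is \<open>j\<close>, whence the
    separate case in \<open>sigma_hat\<close>.\<close>
  also have "\<dots> = cyc_sum {1..j} (inv c) (?N \<circ> (\<lambda>l. l + j))"
    by (rule cyc_sum_cong)
      (auto simp: inv_c sigma_hat_def mat_powi_minus_of_nat[OF U] simp flip: mat_powi_of_nat)
  also have "\<dots> = cyc_sum {j + 1..2 * j} (half_rho j) ?N"
  proof (rule cyc_sum_reindex[symmetric])
    show "bij_betw (\<lambda>l. l + j) {1..j} {j + 1..2 * j}"
      by (rule bij_betw_byWitness[where f' = "\<lambda>l. l - j"]) auto
    show "inv c ` {1..j} \<subseteq> {1..j}"
      using permutes_image[OF permutes_inv[OF c]] by simp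
    show "half_rho j (l + j) = inv c l + j" if "l \<in> {1..j}" for l
      using that by (auto simp: half_rho_def inv_c)
  qed
  finally have 2: "cnj (trace (mat_word H U \<sigma> j)) = cyc_sum {j + 1..2 * j} (half_rho j) ?N" .
  have "{1..2 * j} = {1..j} \<union> {j + 1..2 * j}"
    by auto
  moreover have "cyc_sum ({1..j} \<union> {j + 1..2 * j}) (half_rho j) ?N =
      cyc_sum {1..j} (half_rho j) ?N * cyc_sum {j + 1..2 * j} (half_rho j) ?N"
    by (rule cyc_sum_Un) (use j in \<open>auto simp: half_rho_def\<close>)
  ultimately show ?thesis
    using 1 2 by simp
qed

section \<open>Pairings\<close>

text \<open>Arbitrary ground sets, because the recursion deletes a point together with its partner
  and leaves no initial segment.\<close>

definition pairings_on :: "'b set \<Rightarrow> ('b \<Rightarrow> 'b) set" where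
  "pairings_on F = {\<pi>. \<pi> permutes F \<and> \<pi> \<circ> \<pi> = id \<and> (\<forall>l\<in>F. \<pi> l \<noteq> l)}"

lemma pairings_eq_pairings_on: "pairings m = pairings_on {1..m}"
  by (simp add: pairings_def pairings_on_def)

lemma finite_pairings_on: "finite F \<Longrightarrow> finite (pairings_on F)"
  by (rule finite_subset[OF _ finite_permutations[of F]]) (auto simp: pairings_on_def)

lemma pairings_on_empty [simp]: "pairings_on {} = {id}"
  by (auto simp: pairings_on_def)

text \<open>Composing with the transposition of \<open>x\<close> and its partner turns both into
  fixed points and leaves all other pairs intact.\<close>

lemma pairings_on_remove:
  assumes x: "x \<notin> F" and \<pi>: "\<pi> \<in> pairings_on (insert x F)"
  shows "\<pi> x \<in> F" "Transposition.transpose x (\<pi> x) \<circ> \<pi> \<in> pairings_on (F - {\<pi> x})"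
proof -
  have perm: "\<pi> permutes insert x F" and inv: "\<And>l. \<pi> (\<pi> l) = l"
    and ne: "\<And>l. l \<in> insert x F \<Longrightarrow> \<pi> l \<noteq> l"
    using \<pi> by (auto simp: pairings_on_def o_def id_def fun_eq_iff)
  show m: "\<pi> x \<in> F"
    using permutes_in_image[OF perm, of x] ne[of x] by auto
  let ?\<pi>' = "Transposition.transpose x (\<pi> x) \<circ> \<pi>"
  have fixed: "?\<pi>' x = x" "?\<pi>' (\<pi> x) = \<pi> x"
    by (simp_all add: inv)
  have other: "?\<pi>' l = \<pi> l" "\<pi> l \<noteq> x" "\<pi> l \<noteq> \<pi> x" if "l \<noteq> x" "l \<noteq> \<pi> x" for l
  proof -
    show "\<pi> l \<noteq> x" "\<pi> l \<noteq> \<pi> x"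
      using that inv by metis+
    then show "?\<pi>' l = \<pi> l"
      by (simp add: Transposition.transpose_def)
  qed
  have "?\<pi>' permutes insert x F"
    using perm m by (intro permutes_compose permutes_swap_id) auto
  then have "?\<pi>' permutes F - {\<pi> x}"
    by (rule permutes_superset) (use fixed in auto)
  moreover have "?\<pi>' (?\<pi>' l) = l" for l
    using fixed other inv by (cases "l = x \<or> l = \<pi> x") (auto simp del: o_apply)
  moreover have "?\<pi>' l \<noteq> l" if "l \<in> F - {\<pi> x}" for l
    using that x other(1)[of l] ne[of l] by (cases "l = x") auto
  ultimately show "?\<pi>' \<in> pairings_on (F - {\<pi> x})"
    unfolding pairings_on_def by (auto simp: fun_eq_iff simp del: o_apply simp add: o_apply[of "?\<pi>'" "?\<pi>'"])
qed

lemma pairings_on_insert: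
  assumes x: "x \<notin> F" and m: "m \<in> F" and \<pi>: "\<pi> \<in> pairings_on (F - {m})"
  shows "Transposition.transpose x m \<circ> \<pi> \<in> pairings_on (insert x F)"
    "(Transposition.transpose x m \<circ> \<pi>) x = m" "(Transposition.transpose x m \<circ> \<pi>) m = x"
    "\<And>l. l \<in> F - {m} \<Longrightarrow> (Transposition.transpose x m \<circ> \<pi>) l = \<pi> l"
proof -
  have perm: "\<pi> permutes F - {m}" and inv: "\<And>l. \<pi> (\<pi> l) = l"
    and ne: "\<And>l. l \<in> F - {m} \<Longrightarrow> \<pi> l \<noteq> l"
    using \<pi> by (auto simp: pairings_on_def o_def id_def fun_eq_iff)
  let ?\<pi>' = "Transposition.transpose x m \<circ> \<pi>"
  have fixed: "\<pi> x = x" "\<pi> m = m"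
    using perm x by (auto intro!: permutes_not_in)
  then show x': "?\<pi>' x = m" and m': "?\<pi>' m = x"
    by simp_all
  have "\<pi> l \<noteq> x" "\<pi> l \<noteq> m" if "l \<noteq> x" "l \<noteq> m" for l
    using that fixed inv by metis+
  then have other: "?\<pi>' l = \<pi> l" "\<pi> l \<noteq> x" "\<pi> l \<noteq> m" if "l \<noteq> x" "l \<noteq> m" for l
    using that by (simp_all add: Transposition.transpose_def)
  show "?\<pi>' l = \<pi> l" if "l \<in> F - {m}" for l
    using that x by (intro other(1)) auto
  have "\<pi> permutes insert x F"
    using perm by (rule permutes_subset) auto
  then have "?\<pi>' permutes insert x F"
    using m by (intro permutes_compose permutes_swap_id) auto
  moreover have "?\<pi>' (?\<pi>' l) = l" for l
    using x' m' other inv by (cases "l = x \<or> l = m") (auto simp del: o_apply)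
  moreover have "?\<pi>' l \<noteq> l" if "l \<in> insert x F" for l
    using that x m x' m' other(1)[of l] ne[of l] by (cases "l = x \<or> l = m") (auto simp del: o_apply)
  ultimately show "?\<pi>' \<in> pairings_on (insert x F)"
    unfolding pairings_on_def by (auto simp: fun_eq_iff simp del: o_apply simp add: o_apply[of "?\<pi>'" "?\<pi>'"])
qed

text \<open>Classification by the partner \<open>m\<close> of \<open>x\<close>, the recursion behind
  the double factorials that count pairings.\<close>

lemma sum_pairings_on_insert:
  assumes F: "finite F" "x \<notin> F"
  shows "(\<Sum>\<pi>\<in>pairings_on (insert x F). f \<pi>) =
    (\<Sum>m\<in>F. \<Sum>\<pi>\<in>pairings_on (F - {m}). f (Transposition.transpose x m \<circ> \<pi>))"
proof -
  have "(\<Sum>\<pi>\<in>pairings_on (insert x F). f \<pi>) =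
      (\<Sum>(m, \<pi>)\<in>Sigma F (\<lambda>m. pairings_on (F - {m})). f (Transposition.transpose x m \<circ> \<pi>))"
  proof (rule sum.reindex_bij_witness[where j = "\<lambda>\<pi>. (\<pi> x, Transposition.transpose x (\<pi> x) \<circ> \<pi>)"
        and i = "\<lambda>(m, \<pi>). Transposition.transpose x m \<circ> \<pi>"])
    fix \<pi> assume \<pi>: "\<pi> \<in> pairings_on (insert x F)"
    show "(\<pi> x, Transposition.transpose x (\<pi> x) \<circ> \<pi>) \<in> Sigma F (\<lambda>m. pairings_on (F - {m}))"
      using pairings_on_remove[OF F(2) \<pi>] by simp
  next
    fix p assume "p \<in> Sigma F (\<lambda>m. pairings_on (F - {m}))"
    then obtain m \<pi> where p: "p = (m, \<pi>)" "m \<in> F" "\<pi> \<in> pairings_on (F - {m})"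
      by auto
    note ins = pairings_on_insert[OF F(2) p(2,3)]
    show "(case p of (m, \<pi>) \<Rightarrow> Transposition.transpose x m \<circ> \<pi>) \<in> pairings_on (insert x F)"
      using ins(1) by (simp add: p(1))
    show "((case p of (m, \<pi>) \<Rightarrow> Transposition.transpose x m \<circ> \<pi>) x,
        Transposition.transpose x ((case p of (m, \<pi>) \<Rightarrow> Transposition.transpose x m \<circ> \<pi>) x) \<circ>
          (case p of (m, \<pi>) \<Rightarrow> Transposition.transpose x m \<circ> \<pi>)) = p"
      unfolding p(1) prod.case ins(2) by (simp add: fun_eq_iff)
  qed (simp_all add: o_assoc)
  also have "\<dots> = (\<Sum>m\<in>F. \<Sum>\<pi>\<in>pairings_on (F - {m}). f (Transposition.transpose x m \<circ> \<pi>))"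
    using F by (subst sum.Sigma) (auto simp: finite_pairings_on)
  finally show ?thesis .
qed

text \<open>The combinatorial side of Wick's formula for the product of the entries at
  \<open>(a m, b m)\<close>.\<close>

definition matching_pairings :: "('b \<Rightarrow> 'c) \<Rightarrow> ('b \<Rightarrow> 'c) \<Rightarrow> 'b set \<Rightarrow> complex" where
  "matching_pairings a b F = (\<Sum>\<pi>\<in>pairings_on F. of_bool (\<forall>m\<in>F. a m = b (\<pi> m)))"

text \<open>The pair of \<open>x\<close> and \<open>m\<close> contributes the conditions at both of
  its points. The resulting indicator is the covariance of two GUE entries, so this recursion will
  match the Gaussian one.\<close>

lemma matching_pairings_insert:
  assumes F: "finite F" "x \<notin> F"
  shows "matching_pairings a b (insert x F) =
    (\<Sum>m\<in>F. of_bool (a x = b m \<and> b x = a m) * matching_pairings a b (F - {m}))"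
  unfolding matching_pairings_def sum_pairings_on_insert[OF F] sum_distrib_left
proof (intro sum.cong refl)
  fix m \<pi> assume m: "m \<in> F" and \<pi>: "\<pi> \<in> pairings_on (F - {m})"
  note ins = pairings_on_insert[OF F(2) m \<pi>]
  have "insert x F = {x, m} \<union> (F - {m})"
    using m by auto
  moreover have "(\<forall>l\<in>F - {m}. a l = b ((Transposition.transpose x m \<circ> \<pi>) l)) \<longleftrightarrow> (\<forall>l\<in>F - {m}. a l = b (\<pi> l))"
    using ins(4) by (intro ball_cong) simp_all
  ultimately have "(\<forall>l\<in>insert x F. a l = b ((Transposition.transpose x m \<circ> \<pi>) l)) \<longleftrightarrow>
      (a x = b m \<and> a m = b x) \<and> (\<forall>l\<in>F - {m}. a l = b (\<pi> l))"
    using ins(2,3) by (simp only: ball_Un) (simp del: o_apply)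
  then show "of_bool (\<forall>l\<in>insert x F. a l = b ((Transposition.transpose x m \<circ> \<pi>) l)) =
      of_bool (a x = b m \<and> b x = a m) * (of_bool (\<forall>l\<in>F - {m}. a l = b (\<pi> l)) :: complex)"
    by (simp only: of_bool_conj) auto
qed

section \<open>Gaussian families\<close>

text \<open>Gaussian integration by parts for monomials, read off from the explicit moments: for
  even \<open>k\<close> both sides vanish, for odd \<open>k\<close> it is the ratio of consecutive
  even moments. At \<open>k = 0\<close> the truncated \<open>k - 1\<close> is harmless because of
  the factor \<open>k\<close>.\<close>

lemma (in prob_space) normal_power_moments:
  assumes X: "distributed M lborel X (normal_density 0 s)" and s: "0 < s"
  shows integrable_normal_power: "integrable M (\<lambda>\<omega>. X \<omega> ^ k)"
    and expectation_normal_power_Suc: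
      "expectation (\<lambda>\<omega>. X \<omega> ^ Suc k) = s\<^sup>2 * real k * expectation (\<lambda>\<omega>. X \<omega> ^ (k - 1))"
proof -
  have E: "expectation (\<lambda>\<omega>. X \<omega> ^ k) = (\<integral>x. normal_density 0 s x * x ^ k \<partial>lborel)" for k
    by (rule distributed_integral[OF X, symmetric]) auto
  have even: "expectation (\<lambda>\<omega>. X \<omega> ^ (2 * l)) = fact (2 * l) / ((2 / s\<^sup>2) ^ l * fact l)" for l
    unfolding E using integral_normal_moment_even[OF s, of 0 l] by simp
  have odd: "expectation (\<lambda>\<omega>. X \<omega> ^ (2 * l + 1)) = 0" for l
    unfolding E using integral_normal_moment_odd[OF s, of 0 l] by simp
  have "integrable lborel (\<lambda>x. normal_density 0 s x * x ^ k)"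
  proof (cases "even k")
    case True
    then obtain l where "k = 2 * l" ..
    then show ?thesis
      using normal_moment_even[OF s, of 0 l] by (simp add: has_bochner_integral_iff)
  next
    case False
    then obtain l where "k = 2 * l + 1" ..
    then show ?thesis
      using normal_moment_odd[OF s, of 0 l] by (simp add: has_bochner_integral_iff)
  qed
  then show "integrable M (\<lambda>\<omega>. X \<omega> ^ k)"
    by (subst distributed_integrable[OF X, symmetric]) auto
  show "expectation (\<lambda>\<omega>. X \<omega> ^ Suc k) = s\<^sup>2 * real k * expectation (\<lambda>\<omega>. X \<omega> ^ (k - 1))"
  proof (cases "even k")
    case True
    then obtain l where l: "k = 2 * l" ..
    show ?thesis
    proof (cases l)
      case (Suc l')
      then show ?thesis
        using odd[of l] odd[of l'] by (simp add: l)
    qed (use odd[of 0] in \<open>simp add: l\<close>)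
  next
    case False
    then obtain l where l: "k = 2 * l + 1" ..
    then have "Suc k = 2 * Suc l" "k - 1 = 2 * l"
      by simp_all
    moreover have "fact (2 * Suc l) / ((2 / s\<^sup>2) ^ Suc l * fact (Suc l)) =
        s\<^sup>2 * real k * (fact (2 * l) / ((2 / s\<^sup>2) ^ l * fact l))"
    proof -
      \<comment> \<open>Here \<open>x\<close> is \<open>l + 1\<close> and \<open>y\<close> is
        \<open>k\<close>; the letters \<open>A\<close>, \<open>B\<close>, \<open>C\<close> hide
        factorials and a power from the field arithmetic.\<close>
      have "2 * x * y * A / (2 / s\<^sup>2 * B * (x * C)) = s\<^sup>2 * y * (A / (B * C))"
        if "x \<noteq> 0" "B \<noteq> 0" "C \<noteq> 0" for x y A B C :: real
        using that s by (simp add: field_simps)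
      moreover have "fact (2 * Suc l) = 2 * real (Suc l) * real k * fact (2 * l)"
        by (simp add: l algebra_simps)
      ultimately show ?thesis
        using s by (simp only: power_Suc fact_Suc[of l]) (simp del: of_nat_Suc)
    qed
    ultimately show ?thesis
      by (simp only: even)
  qed
qed

locale gaussian_family = prob_space M for M :: "'a measure" +
  fixes X :: "'t \<Rightarrow> 'a \<Rightarrow> real" and s :: "'t \<Rightarrow> real" and T :: "'t set"
  assumes finite_T: "finite T"
    and s_pos: "t \<in> T \<Longrightarrow> 0 < s t"
    and normal: "t \<in> T \<Longrightarrow> distributed M lborel (X t) (normal_density 0 (s t))"
    and indep: "indep_vars (\<lambda>_. borel) X T"
begin

lemma power_moments:
  shows integrable_powers: "integrable M (\<lambda>\<omega>. \<Prod>t\<in>T. X t \<omega> ^ n t)"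
    and expectation_powers:
      "expectation (\<lambda>\<omega>. \<Prod>t\<in>T. X t \<omega> ^ n t) = (\<Prod>t\<in>T. expectation (\<lambda>\<omega>. X t \<omega> ^ n t))"
proof -
  have ind: "indep_vars (\<lambda>_. borel) (\<lambda>t \<omega>. X t \<omega> ^ n t) T"
    by (rule indep_vars_compose2[OF indep, of "\<lambda>t x. x ^ n t"]) simp
  have int: "integrable M (\<lambda>\<omega>. X t \<omega> ^ n t)" if "t \<in> T" for t
    using that by (intro integrable_normal_power[OF normal s_pos])
  show "integrable M (\<lambda>\<omega>. \<Prod>t\<in>T. X t \<omega> ^ n t)"
    by (rule indep_vars_integrable[OF finite_T ind int])
  show "expectation (\<lambda>\<omega>. \<Prod>t\<in>T. X t \<omega> ^ n t) = (\<Prod>t\<in>T. expectation (\<lambda>\<omega>. X t \<omega> ^ n t))"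
    by (rule indep_vars_lebesgue_integral[OF finite_T ind int])
qed

text \<open>Independence concerns distinct variables, so repeated factors are first collected into
  powers.\<close>

lemma monomial_eq_powers:
  assumes "finite F" "\<tau> ` F \<subseteq> T"
  shows "(\<Prod>m\<in>F. X (\<tau> m) \<omega>) = (\<Prod>t\<in>T. X t \<omega> ^ card {m \<in> F. \<tau> m = t})"
proof -
  have "(\<Prod>m\<in>F. X (\<tau> m) \<omega>) = (\<Prod>t\<in>T. \<Prod>m\<in>{m \<in> F. \<tau> m = t}. X (\<tau> m) \<omega>)"
    by (rule prod.group[OF assms(1) finite_T assms(2), symmetric])
  also have "\<dots> = (\<Prod>t\<in>T. \<Prod>m\<in>{m \<in> F. \<tau> m = t}. X t \<omega>)"
    by (intro prod.cong refl) auto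
  finally show ?thesis
    by simp
qed

lemma mult_monomial_eq_powers:
  assumes "finite F" "\<tau> ` F \<subseteq> T" "t \<in> T"
  shows "X t \<omega> * (\<Prod>m\<in>F. X (\<tau> m) \<omega>) =
    (\<Prod>u\<in>T. X u \<omega> ^ (card {m \<in> F. \<tau> m = u} + of_bool (u = t)))"
  by (simp add: monomial_eq_powers[OF assms(1,2)] power_add prod.distrib mult.commute
      prod.remove[OF finite_T assms(3), of "\<lambda>u. X u \<omega> ^ of_bool (u = t)"])

lemma integrable_monomial:
  "finite F \<Longrightarrow> \<tau> ` F \<subseteq> T \<Longrightarrow> integrable M (\<lambda>\<omega>. \<Prod>m\<in>F. X (\<tau> m) \<omega>)"
  by (simp only: monomial_eq_powers integrable_powers)

lemma integrable_mult_monomial: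
  "finite F \<Longrightarrow> \<tau> ` F \<subseteq> T \<Longrightarrow> t \<in> T \<Longrightarrow> integrable M (\<lambda>\<omega>. X t \<omega> * (\<Prod>m\<in>F. X (\<tau> m) \<omega>))"
  by (simp only: mult_monomial_eq_powers integrable_powers)

text \<open>Integration by parts in \<open>X t\<close>: differentiating the monomial deletes one
  factor \<open>X t\<close> at a time. By independence the other variables contribute only the
  constant \<open>R\<close>.\<close>

lemma expectation_mult_monomial:
  assumes F: "finite F" "\<tau> ` F \<subseteq> T" and t: "t \<in> T"
  shows "expectation (\<lambda>\<omega>. X t \<omega> * (\<Prod>m\<in>F. X (\<tau> m) \<omega>)) =
    (\<Sum>m\<in>F. of_bool (\<tau> m = t) * (s t)\<^sup>2 * expectation (\<lambda>\<omega>. \<Prod>k\<in>F - {m}. X (\<tau> k) \<omega>))"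
proof -
  define n where "n u = card {m \<in> F. \<tau> m = u}" for u
  define R where "R = (\<Prod>u\<in>T - {t}. expectation (\<lambda>\<omega>. X u \<omega> ^ n u))"
  have "expectation (\<lambda>\<omega>. X t \<omega> * (\<Prod>m\<in>F. X (\<tau> m) \<omega>)) =
      expectation (\<lambda>\<omega>. X t \<omega> ^ Suc (n t)) * R"
    unfolding mult_monomial_eq_powers[OF assms] expectation_powers n_def[symmetric] R_def
    by (simp add: prod.remove[OF finite_T t])
  also have "\<dots> = (s t)\<^sup>2 * real (n t) * expectation (\<lambda>\<omega>. X t \<omega> ^ (n t - 1)) * R"
    by (simp only: expectation_normal_power_Suc[OF normal[OF t] s_pos[OF t]])
  \<comment> \<open>The multiplicity \<open>n t\<close> is spent as a sum of equal terms, one for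
    each position that holds \<open>X t\<close>.\<close>
  also have "\<dots> = (\<Sum>m\<in>{m \<in> F. \<tau> m = t}. (s t)\<^sup>2 * (expectation (\<lambda>\<omega>. X t \<omega> ^ (n t - 1)) * R))"
    by (simp add: n_def)
  also have "\<dots> = (\<Sum>m\<in>{m \<in> F. \<tau> m = t}. (s t)\<^sup>2 * expectation (\<lambda>\<omega>. \<Prod>k\<in>F - {m}. X (\<tau> k) \<omega>))"
  proof (intro sum.cong refl)
    fix m assume m: "m \<in> {m \<in> F. \<tau> m = t}"
    have "card {k \<in> F - {m}. \<tau> k = t} = n t - 1"
    proof -
      have "{k \<in> F - {m}. \<tau> k = t} = {k \<in> F. \<tau> k = t} - {m}"
        by auto
      then show ?thesis
        using m by (simp add: n_def)
    qed
    moreover have "card {k \<in> F - {m}. \<tau> k = u} = n u" if "u \<noteq> t" for u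
    proof -
      have "{k \<in> F - {m}. \<tau> k = u} = {k \<in> F. \<tau> k = u}"
        using m that by auto
      then show ?thesis
        by (simp add: n_def)
    qed
    moreover have "expectation (\<lambda>\<omega>. \<Prod>k\<in>F - {m}. X (\<tau> k) \<omega>) =
        (\<Prod>u\<in>T. expectation (\<lambda>\<omega>. X u \<omega> ^ card {k \<in> F - {m}. \<tau> k = u}))"
      using F by (subst monomial_eq_powers) (auto simp: expectation_powers)
    ultimately show "(s t)\<^sup>2 * (expectation (\<lambda>\<omega>. X t \<omega> ^ (n t - 1)) * R) =
        (s t)\<^sup>2 * expectation (\<lambda>\<omega>. \<Prod>k\<in>F - {m}. X (\<tau> k) \<omega>)"
      by (simp add: prod.remove[OF finite_T t] R_def)
  qed
  also have "\<dots> = (\<Sum>m\<in>F. of_bool (\<tau> m = t) * (s t)\<^sup>2 * expectation (\<lambda>\<omega>. \<Prod>k\<in>F - {m}. X (\<tau> k) \<omega>))"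
    using F(1) by (intro sum.mono_neutral_cong_left) auto
  finally show ?thesis .
qed

section \<open>Complex linear combinations of independent Gaussians\<close>

definition lin :: "('t \<Rightarrow> complex) \<Rightarrow> 'a \<Rightarrow> complex" where
  "lin c \<omega> = (\<Sum>t\<in>T. c t * complex_of_real (X t \<omega>))"

text \<open>The expectation of \<open>lin c * lin d\<close>, bilinear and without conjugation, as
  Wick's formula demands.\<close>

definition cov :: "('t \<Rightarrow> complex) \<Rightarrow> ('t \<Rightarrow> complex) \<Rightarrow> complex" where
  "cov c d = (\<Sum>t\<in>T. complex_of_real ((s t)\<^sup>2) * c t * d t)"

lemma prod_lin:
  assumes "finite F"
  shows "(\<Prod>m\<in>F. lin (c m) \<omega>) =
    (\<Sum>\<tau>\<in>F \<rightarrow>\<^sub>E T. (\<Prod>m\<in>F. c m (\<tau> m)) * complex_of_real (\<Prod>m\<in>F. X (\<tau> m) \<omega>))"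
  using assms finite_T by (simp add: lin_def prod_sum_PiE prod.distrib)

lemma lin_mult_prod_lin:
  assumes "finite F"
  shows "lin c0 \<omega> * (\<Prod>m\<in>F. lin (c m) \<omega>) =
    (\<Sum>\<tau>\<in>F \<rightarrow>\<^sub>E T. \<Sum>t\<in>T. c0 t * (\<Prod>m\<in>F. c m (\<tau> m)) *
      complex_of_real (X t \<omega> * (\<Prod>m\<in>F. X (\<tau> m) \<omega>)))"
  unfolding prod_lin[OF assms]
  unfolding lin_def sum_product
  by (subst sum.swap) (simp add: mult_ac)

lemma integrable_prod_lin: "finite F \<Longrightarrow> integrable M (\<lambda>\<omega>. \<Prod>m\<in>F. lin (c m) \<omega>)"
  unfolding prod_lin
  by (intro Bochner_Integration.integrable_sum integrable_mult_right integrable_of_real integrable_monomial) auto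

lemma expectation_prod_lin:
  assumes "finite F"
  shows "(\<integral>\<omega>. (\<Prod>m\<in>F. lin (c m) \<omega>) \<partial>M) =
    (\<Sum>\<tau>\<in>F \<rightarrow>\<^sub>E T. (\<Prod>m\<in>F. c m (\<tau> m)) * complex_of_real (expectation (\<lambda>\<omega>. \<Prod>m\<in>F. X (\<tau> m) \<omega>)))"
proof -
  have int: "integrable M (\<lambda>\<omega>. complex_of_real (\<Prod>m\<in>F. X (\<tau> m) \<omega>))" if "\<tau> \<in> F \<rightarrow>\<^sub>E T" for \<tau>
    using that assms by (intro integrable_of_real integrable_monomial) auto
  have "(\<integral>\<omega>. (\<Prod>m\<in>F. lin (c m) \<omega>) \<partial>M) =
    (\<Sum>\<tau>\<in>F \<rightarrow>\<^sub>E T. (\<Prod>m\<in>F. c m (\<tau> m)) * (\<integral>\<omega>. complex_of_real (\<Prod>m\<in>F. X (\<tau> m) \<omega>) \<partial>M))"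
    unfolding prod_lin[OF assms] using int
    by (simp only: Bochner_Integration.integral_sum integrable_mult_right integral_mult_right_zero)
  then show ?thesis
    by (simp only: integral_complex_of_real)
qed

text \<open>Integration by parts extended by multilinearity: \<open>lin c0\<close> is contracted
  with each other factor in turn. This is one step of Wick's recursion.\<close>

lemma expectation_lin_mult_prod_lin:
  assumes F: "finite F"
  shows "(\<integral>\<omega>. lin c0 \<omega> * (\<Prod>m\<in>F. lin (c m) \<omega>) \<partial>M) =
    (\<Sum>m\<in>F. cov c0 (c m) * (\<integral>\<omega>. (\<Prod>k\<in>F - {m}. lin (c k) \<omega>) \<partial>M))"
proof -
  define E where "E G \<tau> = complex_of_real (expectation (\<lambda>\<omega>. \<Prod>k\<in>G. X (\<tau> k) \<omega>))" for G :: "'b set" and \<tau>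
  have int: "integrable M (\<lambda>\<omega>. complex_of_real (X t \<omega> * (\<Prod>m\<in>F. X (\<tau> m) \<omega>)))"
    if "\<tau> \<in> F \<rightarrow>\<^sub>E T" "t \<in> T" for \<tau> t
    using that F by (intro integrable_of_real integrable_mult_monomial) auto
  have "(\<integral>\<omega>. lin c0 \<omega> * (\<Prod>m\<in>F. lin (c m) \<omega>) \<partial>M) =
    (\<Sum>\<tau>\<in>F \<rightarrow>\<^sub>E T. \<Sum>t\<in>T. c0 t * (\<Prod>m\<in>F. c m (\<tau> m)) *
      (\<integral>\<omega>. complex_of_real (X t \<omega> * (\<Prod>m\<in>F. X (\<tau> m) \<omega>)) \<partial>M))"
    unfolding lin_mult_prod_lin[OF F] using int
    by (simp only: Bochner_Integration.integral_sum Bochner_Integration.integrable_sum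
        integrable_mult_right integral_mult_right_zero cong: sum.cong)
  also have "\<dots> = (\<Sum>\<tau>\<in>F \<rightarrow>\<^sub>E T. \<Sum>t\<in>T. \<Sum>m\<in>F. of_bool (\<tau> m = t) *
      (c0 t * (\<Prod>m\<in>F. c m (\<tau> m)) * complex_of_real ((s t)\<^sup>2) * E (F - {m}) \<tau>))"
  proof (intro sum.cong refl)
    fix \<tau> t assume "\<tau> \<in> F \<rightarrow>\<^sub>E T" "t \<in> T"
    then have "expectation (\<lambda>\<omega>. X t \<omega> * (\<Prod>m\<in>F. X (\<tau> m) \<omega>)) = (\<Sum>m\<in>F. of_bool (\<tau> m = t) * (s t)\<^sup>2 *
        expectation (\<lambda>\<omega>. \<Prod>k\<in>F - {m}. X (\<tau> k) \<omega>))"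
      using F by (intro expectation_mult_monomial) auto
    then show "c0 t * (\<Prod>m\<in>F. c m (\<tau> m)) *
        (\<integral>\<omega>. complex_of_real (X t \<omega> * (\<Prod>m\<in>F. X (\<tau> m) \<omega>)) \<partial>M) =
        (\<Sum>m\<in>F. of_bool (\<tau> m = t) *
          (c0 t * (\<Prod>m\<in>F. c m (\<tau> m)) * complex_of_real ((s t)\<^sup>2) * E (F - {m}) \<tau>))"
      unfolding integral_complex_of_real
      by (simp only: E_def of_real_sum of_real_mult sum_distrib_left)
        (rule sum.cong, simp_all add: of_bool_def)
  qed
  also have "\<dots> = (\<Sum>m\<in>F. \<Sum>\<tau>\<in>F \<rightarrow>\<^sub>E T. \<Sum>t\<in>T. of_bool (\<tau> m = t) *
      (c0 t * (\<Prod>m\<in>F. c m (\<tau> m)) * complex_of_real ((s t)\<^sup>2) * E (F - {m}) \<tau>))"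
    by (subst (2) sum.swap, subst sum.swap) simp
  also have "\<dots> = (\<Sum>m\<in>F. cov c0 (c m) * (\<integral>\<omega>. (\<Prod>k\<in>F - {m}. lin (c k) \<omega>) \<partial>M))"
  proof (intro sum.cong refl)
    fix m assume m: "m \<in> F"
    let ?G = "F - {m}"
    let ?g = "\<lambda>\<tau>. (\<Prod>k\<in>?G. c k (\<tau> k)) * E ?G \<tau>"
    have "(\<Sum>\<tau>\<in>F \<rightarrow>\<^sub>E T. \<Sum>t\<in>T. of_bool (\<tau> m = t) *
        (c0 t * (\<Prod>m\<in>F. c m (\<tau> m)) * complex_of_real ((s t)\<^sup>2) * E ?G \<tau>)) =
        (\<Sum>\<tau>\<in>F \<rightarrow>\<^sub>E T. complex_of_real ((s (\<tau> m))\<^sup>2) * c0 (\<tau> m) * c m (\<tau> m) * ?g \<tau>)"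
    proof (intro sum.cong refl)
      fix \<tau> assume "\<tau> \<in> F \<rightarrow>\<^sub>E T"
      then have "\<tau> m \<in> T"
        using m by auto
      moreover have "(\<Prod>m\<in>F. c m (\<tau> m)) = c m (\<tau> m) * (\<Prod>k\<in>?G. c k (\<tau> k))"
        by (rule prod.remove[OF F m])
      moreover have "(\<Sum>t\<in>T. of_bool (\<tau> m = t) * z t) = z (\<tau> m)" for z :: "'t \<Rightarrow> complex"
        using \<open>\<tau> m \<in> T\<close> finite_T by (simp add: of_bool_def if_distrib[of "\<lambda>x. x * _"] cong: if_cong)
      ultimately show "(\<Sum>t\<in>T. of_bool (\<tau> m = t) *
          (c0 t * (\<Prod>m\<in>F. c m (\<tau> m)) * complex_of_real ((s t)\<^sup>2) * E ?G \<tau>)) =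
          complex_of_real ((s (\<tau> m))\<^sup>2) * c0 (\<tau> m) * c m (\<tau> m) * ?g \<tau>"
        by (simp only:) (simp add: mult_ac)
    qed
    \<comment> \<open>The value of \<open>\<tau>\<close> at \<open>m\<close> is summed separately
      and yields the covariance; the values on \<open>F - {m}\<close> reassemble the remaining
      product.\<close>
    also have "\<dots> = (\<Sum>\<tau>\<in>insert m ?G \<rightarrow>\<^sub>E T. complex_of_real ((s (\<tau> m))\<^sup>2) * c0 (\<tau> m) * c m (\<tau> m) * ?g \<tau>)"
      using m by (simp add: insert_absorb)
    also have "\<dots> = (\<Sum>t\<in>T. \<Sum>\<tau>\<in>?G \<rightarrow>\<^sub>E T. complex_of_real ((s t)\<^sup>2) * c0 t * c m t * ?g (\<tau>(m := t)))"
      by (subst sum_PiE_insert) simp_all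
    also have "\<dots> = (\<Sum>t\<in>T. \<Sum>\<tau>\<in>?G \<rightarrow>\<^sub>E T. complex_of_real ((s t)\<^sup>2) * c0 t * c m t * ?g \<tau>)"
    proof -
      have "?g (\<tau>(m := t)) = ?g \<tau>" for \<tau> t
        unfolding E_def by (intro arg_cong2[of _ _ _ _ "(*)"] arg_cong[of _ _ complex_of_real]
            Bochner_Integration.integral_cong prod.cong refl) auto
      then show ?thesis
        by (simp only:)
    qed
    also have "\<dots> = cov c0 (c m) * (\<Sum>\<tau>\<in>?G \<rightarrow>\<^sub>E T. ?g \<tau>)"
      by (simp add: cov_def sum_product)
    also have "(\<Sum>\<tau>\<in>?G \<rightarrow>\<^sub>E T. ?g \<tau>) = (\<integral>\<omega>. (\<Prod>k\<in>?G. lin (c k) \<omega>) \<partial>M)"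
      using F by (simp add: expectation_prod_lin E_def)
    finally show "(\<Sum>\<tau>\<in>F \<rightarrow>\<^sub>E T. \<Sum>t\<in>T. of_bool (\<tau> m = t) *
        (c0 t * (\<Prod>m\<in>F. c m (\<tau> m)) * complex_of_real ((s t)\<^sup>2) * E ?G \<tau>)) =
        cov c0 (c m) * (\<integral>\<omega>. (\<Prod>k\<in>?G. lin (c k) \<omega>) \<partial>M)" .
  qed
  finally show ?thesis .
qed

end

section \<open>Wick's formula for the GUE\<close>

text \<open>Both sides obey the same recursion: choose \<open>x\<close>, sum over its partner,
  delete both. Two points vanish at once, hence the induction over proper subsets.\<close>

lemma (in gaussian_family) expectation_prod_lin_matching_pairings:
  assumes "finite F"
    and "\<And>m k. m \<in> F \<Longrightarrow> k \<in> F \<Longrightarrow> cov (c m) (c k) = of_bool (a m = b k \<and> b m = a k)"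
  shows "(\<integral>\<omega>. (\<Prod>m\<in>F. lin (c m) \<omega>) \<partial>M) = matching_pairings a b F"
  using assms
proof (induction F rule: finite_psubset_induct)
  case (psubset F)
  show ?case
  proof (cases "F = {}")
    case True
    then show ?thesis
      by (simp add: matching_pairings_def prob_space)
  next
    case False
    then obtain x where x: "x \<in> F"
      by blast
    define G where "G = F - {x}"
    have F: "F = insert x G" "x \<notin> G" "finite G"
      using x psubset.hyps by (auto simp: G_def)
    have "(\<integral>\<omega>. (\<Prod>m\<in>F. lin (c m) \<omega>) \<partial>M) =
        (\<Sum>m\<in>G. cov (c x) (c m) * (\<integral>\<omega>. (\<Prod>k\<in>G - {m}. lin (c k) \<omega>) \<partial>M))"
      using F by (simp add: expectation_lin_mult_prod_lin)
    also have "\<dots> = (\<Sum>m\<in>G. of_bool (a x = b m \<and> b x = a m) * matching_pairings a b (G - {m}))"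
    proof (intro sum.cong refl arg_cong2[of _ _ _ _ "(*)"])
      fix m assume m: "m \<in> G"
      show "cov (c x) (c m) = of_bool (a x = b m \<and> b x = a m)"
        using psubset.prems F(1) m by blast
      show "(\<integral>\<omega>. (\<Prod>k\<in>G - {m}. lin (c k) \<omega>) \<partial>M) = matching_pairings a b (G - {m})"
        using F m by (intro psubset.IH psubset.prems) auto
    qed
    also have "\<dots> = matching_pairings a b F"
      unfolding F(1) by (rule matching_pairings_insert[OF F(3,2), symmetric])
    finally show ?thesis .
  qed
qed

text \<open>The \<open>(x, y)\<close> entry of a GUE matrix is the linear combination with coefficients
  \<open>gue_coeff x y\<close> of the independent real variables of \<^const>\<open>GUE\<close>, which are indexed by
  \<open>gue_index\<close>.\<close>

definition gue_index :: "(('n::linorder \<times> 'n) + ('n \<times> 'n)) set" where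
  "gue_index = {(i, l). i \<le> l} <+> {(i, l). i < l}"

definition gue_sd :: "('n \<times> 'n) + ('n \<times> 'n) \<Rightarrow> real" where
  "gue_sd t = (case t of Inl (i, l) \<Rightarrow> if i = l then 1 else sqrt (1 / 2) | Inr _ \<Rightarrow> sqrt (1 / 2))"

definition gue_coeff :: "'n::linorder \<Rightarrow> 'n \<Rightarrow> ('n \<times> 'n) + ('n \<times> 'n) \<Rightarrow> complex" where
  "gue_coeff x y t =
     (case t of
        Inl p \<Rightarrow> if p = (min x y, max x y) then 1 else 0
      | Inr p \<Rightarrow> if p = (min x y, max x y) then if x < y then \<i> else - \<i> else 0)"

text \<open>On the diagonal the \<open>Inr\<close> pair is no index, so the coefficient that
  \<open>gue_coeff\<close> assigns to it never enters.\<close>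

lemma sum_gue_index:
  fixes f :: "('n::{finite,linorder} \<times> 'n) + ('n \<times> 'n) \<Rightarrow> complex"
  assumes "\<And>p. p \<noteq> (min x y, max x y) \<Longrightarrow> f (Inl p) = 0 \<and> f (Inr p) = 0"
  shows "(\<Sum>t\<in>gue_index. f t) =
    f (Inl (min x y, max x y)) + (if x = y then 0 else f (Inr (min x y, max x y)))"
proof -
  let ?p = "(min x y, max x y)"
  have "(\<Sum>t\<in>gue_index. f t) =
      (\<Sum>p\<in>{(i, l). i \<le> l}. f (Inl p)) + (\<Sum>p\<in>{(i, l). i < l}. f (Inr p))"
    unfolding gue_index_def by (subst sum.Plus) (simp_all add: o_def)
  also have "(\<Sum>p\<in>{(i, l). i \<le> l}. f (Inl p)) = (\<Sum>p\<in>{?p}. f (Inl p))"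
    using assms by (intro sum.mono_neutral_right) (auto simp: min_def max_def)
  also have "(\<Sum>p\<in>{(i, l). i < l}. f (Inr p)) = (\<Sum>p\<in>(if x = y then {} else {?p}). f (Inr p))"
  proof (rule sum.mono_neutral_right)
    show "\<forall>p\<in>{(i, l). i < l} - (if x = y then {} else {?p}). f (Inr p) = 0"
    proof
      fix p assume "p \<in> {(i, l). i < l} - (if x = y then {} else {?p})"
      then have "p \<noteq> ?p"
        by (auto split: if_splits)
      then show "f (Inr p) = 0"
        using assms by blast
    qed
  qed (auto simp: min_def max_def)
  finally show ?thesis
    by simp
qed

text \<open>Off the diagonal real and imaginary part have variance 1/2 each: equal positions give
  1/2 + \<i>^2/2 = 0, transposed ones 1/2 - \<i>^2/2 = 1. On the diagonal the single real variable
  has variance 1.\<close>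

lemma gue_cov:
  fixes x y x' y' :: "'n::{finite,linorder}"
  shows "(\<Sum>t\<in>gue_index. complex_of_real ((gue_sd t)\<^sup>2) * gue_coeff x y t * gue_coeff x' y' t) =
    of_bool (x = y' \<and> y = x')"
proof -
  let ?p = "(min x y, max x y)"
  let ?h = "\<lambda>t. complex_of_real ((gue_sd t)\<^sup>2) * gue_coeff x y t * gue_coeff x' y' t"
  have sum: "(\<Sum>t\<in>gue_index. ?h t) = ?h (Inl ?p) + (if x = y then 0 else ?h (Inr ?p))"
    by (rule sum_gue_index) (auto simp: gue_coeff_def)
  have eq: "?p = (min x' y', max x' y') \<longleftrightarrow> x = x' \<and> y = y' \<or> x = y' \<and> y = x'"
    by (auto simp: min_def max_def split: if_splits)
  have sd: "(gue_sd (Inl ?p))\<^sup>2 = (if x = y then 1 else 1 / 2)" "(gue_sd (Inr ?p))\<^sup>2 = 1 / 2"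
    by (auto simp: gue_sd_def min_def max_def)
  have coeff: "gue_coeff x y (Inl ?p) = 1" "gue_coeff x y (Inr ?p) = (if x < y then \<i> else - \<i>)"
    "gue_coeff x' y' (Inl ?p) = of_bool (x = x' \<and> y = y' \<or> x = y' \<and> y = x')"
    "gue_coeff x' y' (Inr ?p) =
      (if x = x' \<and> y = y' \<or> x = y' \<and> y = x' then if x' < y' then \<i> else - \<i> else 0)"
    by (simp_all only: gue_coeff_def sum.case eq) simp_all
  consider "x = y" | "x \<noteq> y" "x' = x" "y' = y" | "x < y" "x' = y" "y' = x" | "y < x" "x' = y" "y' = x"
    | "\<not> (x = x' \<and> y = y')" "\<not> (x = y' \<and> y = x')"
    by (metis linorder_neqE)
  then show ?thesis
    unfolding sum sd coeff
  proof cases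
    case 1
    then show "complex_of_real (if x = y then 1 else 1 / 2) * 1 *
        of_bool (x = x' \<and> y = y' \<or> x = y' \<and> y = x') +
        (if x = y then 0 else complex_of_real (1 / 2) * (if x < y then \<i> else - \<i>) *
          (if x = x' \<and> y = y' \<or> x = y' \<and> y = x' then if x' < y' then \<i> else - \<i> else 0)) =
        of_bool (x = y' \<and> y = x')"
      by (simp only: of_bool_def) auto
  qed auto
qed

text \<open>The entries are identified with the combinations \<open>lin\<close> on
  \<open>space M\<close> only, where \<open>H\<close> is Hermitian; this suffices for
  integrals.\<close>

lemma GUE_moments:
  fixes H :: "'a \<Rightarrow> complex^'n::{finite,linorder}^'n::{finite,linorder}"
  assumes M: "prob_space M" and H: "GUE M H" and F: "finite F"
  shows integrable_prod_GUE: "integrable M (\<lambda>\<omega>. \<Prod>m\<in>F. H \<omega> $ a m $ b m)"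
    and expectation_prod_GUE: "(\<integral>\<omega>. (\<Prod>m\<in>F. H \<omega> $ a m $ b m) \<partial>M) = matching_pairings a b F"
proof -
  define X where "X = case_sum (\<lambda>(i, l) \<omega>. Re (H \<omega> $ i $ l)) (\<lambda>(i, l) \<omega>. Im (H \<omega> $ i $ l))"
  interpret prob_space M
    by (rule M)
  interpret gaussian_family M X gue_sd gue_index
  proof
    show "finite (gue_index :: (('n \<times> 'n) + ('n \<times> 'n)) set)"
      by simp
    show "0 < gue_sd t" for t :: "('n \<times> 'n) + ('n \<times> 'n)"
      by (auto simp: gue_sd_def split: sum.split)
    show "distributed M lborel (X t) (normal_density 0 (gue_sd t))" if "t \<in> gue_index" for t
      using that H by (auto simp: gue_index_def X_def gue_sd_def GUE_def order.order_iff_strict)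
    show "indep_vars (\<lambda>_. borel) X gue_index"
      using H by (simp add: GUE_def X_def gue_index_def)
  qed
  have lin: "H \<omega> $ x $ y = lin (gue_coeff x y) \<omega>" if \<omega>: "\<omega> \<in> space M" for \<omega> x y
  proof -
    have sym: "H \<omega> $ x $ y = cnj (H \<omega> $ y $ x)" for x y
      using H \<omega> conj_transpose_nth[of "H \<omega>" x y] by (simp add: GUE_def)
    then have real: "Im (H \<omega> $ x $ x) = 0" for x
      by (metis cnj.simps(2) complex_cnj_cancel_iff equal_neg_zero)
    have "lin (gue_coeff x y) \<omega> =
        gue_coeff x y (Inl (min x y, max x y)) * complex_of_real (X (Inl (min x y, max x y)) \<omega>) +
        (if x = y then 0 else
          gue_coeff x y (Inr (min x y, max x y)) * complex_of_real (X (Inr (min x y, max x y)) \<omega>))"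
      unfolding lin_def by (rule sum_gue_index) (auto simp: gue_coeff_def)
    also have "\<dots> = H \<omega> $ x $ y"
      using sym[of x y] real[of x]
      by (auto simp: gue_coeff_def X_def min_def max_def complex_eq_iff)
    finally show ?thesis ..
  qed
  have "integrable M (\<lambda>\<omega>. \<Prod>m\<in>F. lin (gue_coeff (a m) (b m)) \<omega>)"
    by (rule integrable_prod_lin[OF F])
  then show "integrable M (\<lambda>\<omega>. \<Prod>m\<in>F. H \<omega> $ a m $ b m)"
    by (rule Bochner_Integration.integrable_cong[THEN iffD1, rotated 2]) (simp_all add: lin)
  have "(\<integral>\<omega>. (\<Prod>m\<in>F. H \<omega> $ a m $ b m) \<partial>M) = (\<integral>\<omega>. (\<Prod>m\<in>F. lin (gue_coeff (a m) (b m)) \<omega>) \<partial>M)"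
    by (rule Bochner_Integration.integral_cong) (simp_all add: lin)
  also have "\<dots> = matching_pairings a b F"
    by (rule expectation_prod_lin_matching_pairings[OF F]) (simp only: cov_def gue_cov)
  finally show "(\<integral>\<omega>. (\<Prod>m\<in>F. H \<omega> $ a m $ b m) \<partial>M) = matching_pairings a b F" .
qed

text \<open>The constraint fixes \<open>a\<close> on \<open>W\<close> and extensionality fixes it
  elsewhere, so exactly one summand survives.\<close>

lemma sum_matching:
  fixes h :: "('i \<Rightarrow> 'c :: finite) \<Rightarrow> complex"
  assumes "finite W"
  shows "(\<Sum>a\<in>W \<rightarrow>\<^sub>E UNIV. of_bool (\<forall>m\<in>W. a m = b (\<pi> m)) * h a) = h (restrict (b \<circ> \<pi>) W)"
proof -
  have fin: "finite (W \<rightarrow>\<^sub>E (UNIV :: 'c set))"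
    using assms by (intro finite_PiE) auto
  have "(\<forall>m\<in>W. a m = b (\<pi> m)) \<longleftrightarrow> a = restrict (b \<circ> \<pi>) W" if "a \<in> W \<rightarrow>\<^sub>E UNIV" for a
    using that by (auto simp: fun_eq_iff restrict_def PiE_def extensional_def)
  then have "(\<Sum>a\<in>W \<rightarrow>\<^sub>E UNIV. of_bool (\<forall>m\<in>W. a m = b (\<pi> m)) * h a) =
      (\<Sum>a\<in>W \<rightarrow>\<^sub>E UNIV. if a = restrict (b \<circ> \<pi>) W then h a else 0)"
    by (intro sum.cong refl) auto
  also have "\<dots> = h (restrict (b \<circ> \<pi>) W)"
    using fin by (simp add: sum.delta)
  finally show ?thesis .
qed

text \<open>Integrability is asserted along with the identity, because the Bochner integral of a
  non-integrable function is 0 by convention.\<close>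

theorem proposition4p1:
  fixes M :: "'a measure"
    and H U :: "'a \<Rightarrow> complex^'n::{finite,linorder}^'n::{finite,linorder}"
    and j :: nat and \<sigma> :: "nat \<Rightarrow> nat"
  assumes "prob_space M"
    and "GUE M H"
    and "haar_distributed M U"
    and "prob_space.indep_var M borel H unitary_borel U"
    and "j \<ge> 1"
  shows "integrable M (\<lambda>\<omega>. trace (mat_word (H \<omega>) (U \<omega>) \<sigma> j) * cnj (trace (mat_word (H \<omega>) (U \<omega>) \<sigma> j)))
    \<and> (\<forall>\<pi>\<in>pairings (2 * j). integrable M (\<lambda>\<omega>. \<Prod>o'\<in>even_orbits j \<pi>.
          trace (mat_powi (U \<omega>) (\<Sum>w\<in>o'. sigma_hat \<sigma> j w))))
    \<and> (\<integral>\<omega>. trace (mat_word (H \<omega>) (U \<omega>) \<sigma> j) * cnj (trace (mat_word (H \<omega>) (U \<omega>) \<sigma> j)) \<partial>M)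
      = (\<Sum>\<pi>\<in>pairings (2 * j). \<integral>\<omega>. (\<Prod>o'\<in>even_orbits j \<pi>.
          trace (mat_powi (U \<omega>) (\<Sum>w\<in>o'. sigma_hat \<sigma> j w))) \<partial>M)"
proof -
  interpret prob_space M
    by fact
  note j = \<open>j \<ge> 1\<close>
  define W where "W = {1..2 * j}"
  have W: "finite W"
    by (simp add: W_def)
  let ?P = "W \<rightarrow>\<^sub>E (UNIV :: 'n set)"
  define N where "N A l = mat_powi A (sigma_hat \<sigma> j (2 * l))" for A :: "complex^'n::{finite,linorder}^'n::{finite,linorder}" and l
  define f where "f a b B = (\<Prod>w\<in>W. B $ a w $ b w)" for a b :: "nat \<Rightarrow> 'n" and B :: "complex^'n::{finite,linorder}^'n::{finite,linorder}"
  define g where "g a b A = (\<Prod>w\<in>W. N A w $ b w $ a (half_rho j w))"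
    for a b :: "nat \<Rightarrow> 'n" and A :: "complex^'n::{finite,linorder}^'n::{finite,linorder}"
  define T where "T \<omega> = trace (mat_word (H \<omega>) (U \<omega>) \<sigma> j) * cnj (trace (mat_word (H \<omega>) (U \<omega>) \<sigma> j))" for \<omega>
  define R where "R \<pi> \<omega> = (\<Prod>o'\<in>even_orbits j \<pi>. trace (mat_powi (U \<omega>) (\<Sum>w\<in>o'. sigma_hat \<sigma> j w)))" for \<pi> \<omega>

  have U_meas [measurable]: "U \<in> measurable M unitary_borel"
    using assms(3) by (simp add: haar_distributed_def)
  have U: "U \<omega> \<in> unitary_matrices" if "\<omega> \<in> space M" for \<omega>
    using measurable_space[OF U_meas that] by (simp add: unitary_borel_def space_restrict_space)
  have g_meas: "g a b \<in> borel_measurable unitary_borel" for a b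
    unfolding g_def N_def by measurable
  have f_meas: "f a b \<in> borel_measurable borel" for a b
    unfolding f_def by measurable
  have g_int: "integrable M (\<lambda>\<omega>. g a b (U \<omega>))" for a b
  proof (rule integrable_const_bound[where B = 1])
    show "AE \<omega> in M. norm (g a b (U \<omega>)) \<le> 1"
      unfolding g_def prod_norm[symmetric] N_def
      by (intro AE_I2 prod_le_1) (auto intro!: norm_unitary_nth_le_1 unitary_mat_powi U)
    show "(\<lambda>\<omega>. g a b (U \<omega>)) \<in> borel_measurable M"
      using measurable_compose[OF U_meas g_meas] .
  qed
  have f_int: "integrable M (\<lambda>\<omega>. f a b (H \<omega>))"
    and f_exp: "(\<integral>\<omega>. f a b (H \<omega>) \<partial>M) = matching_pairings a b W" for a b
    unfolding f_def using integrable_prod_GUE[OF assms(1,2) W] expectation_prod_GUE[OF assms(1,2) W]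
    by blast+
  \<comment> \<open>For fixed \<open>a\<close> and \<open>b\<close> the integrand is a function of
    \<open>H\<close> times a function of \<open>U\<close>, so independence applies term by
    term.\<close>
  have ind: "indep_var borel (\<lambda>\<omega>. f a b (H \<omega>)) borel (\<lambda>\<omega>. g a b (U \<omega>))" for a b
    using indep_var_compose[OF assms(4) f_meas g_meas] by (simp add: o_def)
  note fg_int = indep_var_integrable[OF ind f_int g_int]
  note fg_exp = indep_var_lebesgue_integral[OF ind f_int g_int]

  have T_eq: "T \<omega> = (\<Sum>a\<in>?P. \<Sum>b\<in>?P. f a b (H \<omega>) * g a b (U \<omega>))" if "\<omega> \<in> space M" for \<omega>
  proof -
    have "conj_transpose (H \<omega>) = H \<omega>"
      using assms(2) that by (simp add: GUE_def)
    then have "T \<omega> = cyc_sum W (half_rho j) (\<lambda>l. H \<omega> ** N (U \<omega>) l)"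
      unfolding T_def N_def W_def using U[OF that] j by (rule trace_mult_cnj_trace_mat_word)
    then show ?thesis
      unfolding cyc_sum_mult[OF W] by (simp add: f_def g_def prod.distrib)
  qed
  have R_eq: "R \<pi> \<omega> = (\<Sum>b\<in>?P. g (restrict (b \<circ> \<pi>) W) b (U \<omega>))"
    if "\<pi> \<in> pairings (2 * j)" "\<omega> \<in> space M" for \<pi> \<omega>
  proof -
    have \<pi>: "\<pi> permutes {1..2 * j}"
      using that(1) by (simp add: pairings_def)
    have "R \<pi> \<omega> = cyc_sum W (\<pi> \<circ> half_rho j) (N (U \<omega>))"
      unfolding R_def N_def W_def by (rule prod_even_orbits[OF U[OF that(2)] j \<pi>])
    \<comment> \<open>\<open>half_rho j\<close> maps \<open>W\<close> into itself, so the
      restriction does not affect the index \<open>b (\<pi> (half_rho j w))\<close>.\<close>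
    then show ?thesis
      unfolding cyc_sum_def g_def W_def
      using permutes_in_image[OF half_rho_permutes[OF j]] by simp
  qed

  have T_int: "integrable M T"
  proof (rule Bochner_Integration.integrable_cong[THEN iffD2])
    show "integrable M (\<lambda>\<omega>. \<Sum>a\<in>?P. \<Sum>b\<in>?P. f a b (H \<omega>) * g a b (U \<omega>))"
      by (intro Bochner_Integration.integrable_sum fg_int)
  qed (simp_all add: T_eq)
  have R_int: "integrable M (R \<pi>)" if "\<pi> \<in> pairings (2 * j)" for \<pi>
  proof (rule Bochner_Integration.integrable_cong[THEN iffD2])
    show "integrable M (\<lambda>\<omega>. \<Sum>b\<in>?P. g (restrict (b \<circ> \<pi>) W) b (U \<omega>))"
      by (intro Bochner_Integration.integrable_sum g_int)
  qed (simp_all add: R_eq that)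
  have R_exp: "(\<integral>\<omega>. R \<pi> \<omega> \<partial>M) = (\<Sum>b\<in>?P. \<integral>\<omega>. g (restrict (b \<circ> \<pi>) W) b (U \<omega>) \<partial>M)"
    if "\<pi> \<in> pairings (2 * j)" for \<pi>
  proof -
    have "(\<integral>\<omega>. R \<pi> \<omega> \<partial>M) = (\<integral>\<omega>. (\<Sum>b\<in>?P. g (restrict (b \<circ> \<pi>) W) b (U \<omega>)) \<partial>M)"
      by (rule Bochner_Integration.integral_cong) (simp_all add: R_eq that)
    then show ?thesis
      using g_int by (simp add: Bochner_Integration.integral_sum)
  qed

  have "(\<integral>\<omega>. T \<omega> \<partial>M) = (\<integral>\<omega>. (\<Sum>a\<in>?P. \<Sum>b\<in>?P. f a b (H \<omega>) * g a b (U \<omega>)) \<partial>M)"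
    by (rule Bochner_Integration.integral_cong) (simp_all add: T_eq)
  also have "\<dots> = (\<Sum>a\<in>?P. \<Sum>b\<in>?P. matching_pairings a b W * (\<integral>\<omega>. g a b (U \<omega>) \<partial>M))"
    using fg_int by (simp add: Bochner_Integration.integral_sum Bochner_Integration.integrable_sum fg_exp f_exp)
  also have "\<dots> = (\<Sum>a\<in>?P. \<Sum>b\<in>?P. \<Sum>\<pi>\<in>pairings (2 * j).
      of_bool (\<forall>m\<in>W. a m = b (\<pi> m)) * (\<integral>\<omega>. g a b (U \<omega>) \<partial>M))"
    by (simp add: matching_pairings_def pairings_eq_pairings_on W_def sum_distrib_right)
  \<comment> \<open>The sum over \<open>a\<close> goes innermost, since for given
    \<open>\<pi>\<close> and \<open>b\<close> the matching condition determines
    \<open>a\<close>.\<close>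
  also have "\<dots> = (\<Sum>\<pi>\<in>pairings (2 * j). \<Sum>b\<in>?P. \<Sum>a\<in>?P.
      of_bool (\<forall>m\<in>W. a m = b (\<pi> m)) * (\<integral>\<omega>. g a b (U \<omega>) \<partial>M))"
    by (subst sum.swap, subst (2) sum.swap, subst sum.swap) simp
  also have "\<dots> = (\<Sum>\<pi>\<in>pairings (2 * j). \<Sum>b\<in>?P. \<integral>\<omega>. g (restrict (b \<circ> \<pi>) W) b (U \<omega>) \<partial>M)"
  proof (intro sum.cong refl)
    fix \<pi> b
    show "(\<Sum>a\<in>?P. of_bool (\<forall>m\<in>W. a m = b (\<pi> m)) * (\<integral>\<omega>. g a b (U \<omega>) \<partial>M)) =
        (\<integral>\<omega>. g (restrict (b \<circ> \<pi>) W) b (U \<omega>) \<partial>M)"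
      by (rule sum_matching[OF W, where h = "\<lambda>a. \<integral>\<omega>. g a b (U \<omega>) \<partial>M"])
  qed
  also have "\<dots> = (\<Sum>\<pi>\<in>pairings (2 * j). \<integral>\<omega>. R \<pi> \<omega> \<partial>M)"
    by (simp add: R_exp)
  finally have "(\<integral>\<omega>. T \<omega> \<partial>M) = (\<Sum>\<pi>\<in>pairings (2 * j). \<integral>\<omega>. R \<pi> \<omega> \<partial>M)" .
  then show ?thesis
    using T_int R_int unfolding T_def R_def by blast
qed

end
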